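(* Let $G$ be a rootless directed tree without leaves, with edges $\{e_i : i\in I\}$. Let $\rho=(\rho_i)_{i\in I}$ be a $1$-admissible weight, so that the left translation semigroup $(T_t)_{t\ge0}$ is strongly continuous on $L^1_\rho(L(G))$. Let $\mathcal F$ be a proper, finite invariant Furstenberg family on $\mathbb R_+$. For $i\in I$, $t\ge0$, $s\in[0,1)$ put $$\Phi_i^{(1)}(t,s)=\inf_{j\in M_{n(t,s)}(i)}\rho_j(\sigma(t,s)),$$ $$\Psi_i^{(1)}(t,s)=\inf\Bigl\{\rho_{K_{n(t,s)}(i)}(s),\ \inf_{j\in M_{n(t,s)}(K_{n(t,s)}(i))}\rho_j(\sigma(t,s))\Bigr\}.$$ For every finite nonempty set $K\subset I$, $\varepsilon>0$ and $0<\alpha<1$, define $$\mathcal N_1(K,\varepsilon,\alpha)=\Bigl\{t\ge0:\ \inf_{E\subset[0,1)\text{ measurable},\ m(E)>\alpha}\ \int_E\sum_{i\in K}\bigl(\Phi_i^{(1)}(t,s)+\Psi_i^{(1)}(t,s)\bigr)\,ds<\varepsilon\Bigr\},$$ where $m$ is Lebesgue measure. Then the following assertions are equivalent: (i) $(T_t)_{t\ge0}$ is $\mathcal F$-transitive on $L^1_\rho(L(G))$; (ii) for every finite nonempty set $K\subset I$, every $\varepsilon>0$ and every $0<\alpha<1$, one has $\mathcal N_1(K,\varepsilon,\alpha)\in\mathcal F$; (iii) $(T_t)_{t\ge0}$ is topologically $\mathcal F$-recurrent on $L^1_\rho(L(G))$.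
   Context: **Directed trees.** A directed tree is a directed graph $G=(V,E)$ that is connected (as an undirected graph), contains no cycles, in which every vertex $v$ has at most one parent (at most one $u\in V$ with $(u,v)\in E$), and with $V$ countable. If $(u,v)\in E$, then $u$ is the parent of $v$ and $v$ a child of $u$; $u$ is the tail and $v$ the head of the edge $(u,v)$. A leaf is a vertex without children, a root is a vertex without a parent; $G$ is rootless if it has no root. Write $E=\{e_i:i\in I\}$ with $I$ countable (distinct indices giving distinct edges). For $i\in I$ let $M_0(i)=\{i\}$ and $M_{n+1}(i)=\{j\in I:\text{the head of } e_k \text{ is the tail of } e_j \text{ for some } k\in M_n(i)\}$, $n\in\mathbb N_0$. When $G$ is rootless, for $i\in I$ and $n\in\mathbb N_0$, $K_n(i)\in I$ denotes the (unique, existing) index of the $n$-th ancestor edge of $e_i$: $K_0(i)=i$ and $i\in M_n(K_n(i))$. **Weighted spaces.** The directed metric tree $L(G)$ is obtained by replacing each edge by a copy of $[0,1)$, with coordinate increasing from tail to head. A function on $L(G)$ is identified with a family $f=(f_i)_{i\in I}$, $f_i:[0,1)\to\mathbb K$, where $\mathbb K=\mathbb R$ or $\mathbb C$. A weight is a family $\rho=(\rho_i)_{i\in I}$ with $\rho_i\in L^1([0,1))$ and $\rho_i(s)>0$ for every $s\in[0,1)$. $L^1_\rho(L(G))$ is the Banach space of (classes of a.e. equal) measurable families $f=(f_i)_{i\in I}$ with norm $\|f\|_{1,\rho}=\sum_{i\in I}\int_0^1|f_i(s)|\rho_i(s)\,ds<\infty$. **Left translation semigroup.** For $t\ge0$,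 $s\in[0,1)$ set $n(t,s)=\lfloor t+s\rfloor$ and $\sigma(t,s)=t+s-n(t,s)\in[0,1)$. For $t\ge 0$, $(T_tf)_i(s)=\sum_{j\in M_{n(t,s)}(i)}f_j(\sigma(t,s))$ for $i\in I$ and a.e. $s\in[0,1)$ (empty sums are $0$). **Admissibility.** $\rho$ is $1$-admissible if there exist $M\ge1$ and $\omega\in\mathbb R$ such that for every $i\in I$, $t\ge0$, $s\in[0,1)$: $$\rho_i(s)\le Me^{\omega t}\inf_{j\in M_{n(t,s)}(i)}\rho_j(\sigma(t,s)).$$ It is known that if $\rho$ is $1$-admissible, then $(T_t)_{t\ge0}$ is a strongly continuous semigroup of bounded linear operators on $L^1_\rho(L(G))$ with $\|T_t\|\le Me^{\omega t}$. **Furstenberg families.** A Furstenberg family on $\mathbb R_+=[0,\infty)$ is a nonempty collection $\mathcal F$ of subsets of $\mathbb R_+$ such that $A\in\mathcal F$ and $A\subset B\subset\mathbb R_+$ imply $B\in\mathcal F$. It is proper if $\varnothing\notin\mathcal F$ (and $\mathcal F\ne\varnothing$), and finite invariant if $A\in\mathcal F$, $R>0$ imply $A\cap(R,\infty)\in\mathcal F$. For a semigroup $(T_t)_{t\ge0}$ on $X$ and nonempty open $U,V\subset X$, let $N(U,V)=\{t\ge0:T_t(U)\cap V\ne\varnothing\}$. The semigroup is $\mathcal F$-transitive if $N(U,V)\in\mathcal F$ for all nonempty open $U,V\subset X$, and topologically $\mathcal F$-recurrent if $N(U,U)\in\mathcal F$ for every nonempty open $U\subset X$. *)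

theory Defs
  imports "HOL-Analysis.Analysis" "Graph_Theory.Digraph_Component"
begin

section \<open>Directed trees\<close>

text \<open>
  The arcs of the digraph serve as the index set \<open>I\<close> of the edges; a digraph without multiple arcs
  is one in which distinct indices give distinct edges. The predicate \<open>tree\<close> of the library says
  that the underlying undirected graph is connected (hence nonempty) and that there is no directed
  cycle, loops included. Since every vertex has at most one parent, the latter also excludes
  cycles of the underlying undirected graph.
\<close>

locale directed_tree = nomulti_digraph G for G :: "('v, 'i) pre_digraph" (structure) +
  assumes tree: "tree G"
    and parent_unique:
      "\<lbrakk>e1 \<in> arcs G; e2 \<in> arcs G; head G e1 = head G e2\<rbrakk> \<Longrightarrow> tail G e1 = tail G e2"
    and countable_verts: "countable (verts G)"

definition is_root :: "('v, 'i) pre_digraph \<Rightarrow> 'v \<Rightarrow> bool" where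
  "is_root G v \<longleftrightarrow> v \<in> verts G \<and> \<not> (\<exists>e\<in>arcs G. head G e = v)"

definition is_leaf :: "('v, 'i) pre_digraph \<Rightarrow> 'v \<Rightarrow> bool" where
  "is_leaf G v \<longleftrightarrow> v \<in> verts G \<and> \<not> (\<exists>e\<in>arcs G. tail G e = v)"

text \<open>\<open>desc G n i\<close> is the set \<open>M\<^sub>n(i)\<close> and \<open>anc G n i\<close> is the index \<open>K\<^sub>n(i)\<close>.\<close>

primrec desc :: "('v, 'i) pre_digraph \<Rightarrow> nat \<Rightarrow> 'i \<Rightarrow> 'i set" where
  "desc G 0 i = {i}"
| "desc G (Suc n) i = {j \<in> arcs G. \<exists>k\<in>desc G n i. head G k = tail G j}"

definition anc :: "('v, 'i) pre_digraph \<Rightarrow> nat \<Rightarrow> 'i \<Rightarrow> 'i" where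
  "anc G n i = (THE k. k \<in> arcs G \<and> i \<in> desc G n k)"

section \<open>Weights and the weighted space\<close>

abbreviation unit_lebesgue :: "real measure" where
  "unit_lebesgue \<equiv> lebesgue_on {0..<1}"

definition is_weight :: "('v, 'i) pre_digraph \<Rightarrow> ('i \<Rightarrow> real \<Rightarrow> real) \<Rightarrow> bool" where
  "is_weight G \<rho> \<longleftrightarrow>
     (\<forall>i\<in>arcs G. integrable unit_lebesgue (\<rho> i) \<and> (\<forall>s\<in>{0..<1}. \<rho> i s > 0))"

text \<open>
  A family \<open>(f\<^sub>i)\<close> is given by a total function; its values at indices outside \<open>arcs G\<close> and at
  points outside \<open>[0,1)\<close> are irrelevant, and \<open>L1_eq\<close> below disregards them.
  Up to isometric isomorphism, \<open>\<real>\<close> and \<open>\<complex>\<close> are the only instances of the classes required of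
  the scalars. The norm is computed in \<open>[0,\<infinity>]\<close>, so that finiteness can be expressed.
\<close>

definition L1_norm ::
    "('v, 'i) pre_digraph \<Rightarrow> ('i \<Rightarrow> real \<Rightarrow> real) \<Rightarrow> ('i \<Rightarrow> real \<Rightarrow> 'k::real_normed_field) \<Rightarrow> ennreal" where
  "L1_norm G \<rho> f = (\<Sum>\<^sub>\<infinity>i\<in>arcs G. \<integral>\<^sup>+s. ennreal (norm (f i s) * \<rho> i s) \<partial>unit_lebesgue)"

definition L1_families ::
    "('v, 'i) pre_digraph \<Rightarrow> ('i \<Rightarrow> real \<Rightarrow> real)
      \<Rightarrow> ('i \<Rightarrow> real \<Rightarrow> 'k::{real_normed_field, euclidean_space}) set" where
  "L1_families G \<rho> =
     {f. (\<forall>i\<in>arcs G. f i \<in> borel_measurable unit_lebesgue) \<and> L1_norm G \<rho> f < \<infinity>}"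

definition L1_eq ::
    "('v, 'i) pre_digraph \<Rightarrow> ('i \<Rightarrow> real \<Rightarrow> real)
      \<Rightarrow> (('i \<Rightarrow> real \<Rightarrow> 'k::{real_normed_field, euclidean_space}) \<times> ('i \<Rightarrow> real \<Rightarrow> 'k)) set" where
  "L1_eq G \<rho> = {(f, g). f \<in> L1_families G \<rho> \<and> g \<in> L1_families G \<rho> \<and>
     (\<forall>i\<in>arcs G. AE s in unit_lebesgue. f i s = g i s)}"

definition L1_space ::
    "('v, 'i) pre_digraph \<Rightarrow> ('i \<Rightarrow> real \<Rightarrow> real)
      \<Rightarrow> ('i \<Rightarrow> real \<Rightarrow> 'k::{real_normed_field, euclidean_space}) set set" where
  "L1_space G \<rho> = L1_families G \<rho> // L1_eq G \<rho>"

definition rep :: "'x set \<Rightarrow> 'x" where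
  "rep F = (SOME f. f \<in> F)"

definition L1_dist ::
    "('v, 'i) pre_digraph \<Rightarrow> ('i \<Rightarrow> real \<Rightarrow> real)
      \<Rightarrow> ('i \<Rightarrow> real \<Rightarrow> 'k::{real_normed_field, euclidean_space}) set
      \<Rightarrow> ('i \<Rightarrow> real \<Rightarrow> 'k) set \<Rightarrow> real" where
  "L1_dist G \<rho> F H = enn2real (L1_norm G \<rho> (\<lambda>i s. rep F i s - rep H i s))"

definition L1_topology ::
    "('v, 'i) pre_digraph \<Rightarrow> ('i \<Rightarrow> real \<Rightarrow> real)
      \<Rightarrow> ('i \<Rightarrow> real \<Rightarrow> 'k::{real_normed_field, euclidean_space}) set topology" where
  "L1_topology G \<rho> = Metric_space.mtopology (L1_space G \<rho>) (L1_dist G \<rho>)"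

section \<open>Left translation semigroup and admissibility\<close>

text \<open>\<open>frac (t + s)\<close> is \<open>\<sigma>(t,s)\<close>.\<close>

definition jump :: "real \<Rightarrow> real \<Rightarrow> nat" where
  "jump t s = nat \<lfloor>t + s\<rfloor>"

text \<open>
  The sum over the descendants may be infinite. For an admissible weight and an integrable family
  it converges absolutely for almost every \<open>s\<close>; on the remaining null set it is \<open>0\<close> by convention.
\<close>

definition translate_family ::
    "('v, 'i) pre_digraph \<Rightarrow> real
      \<Rightarrow> ('i \<Rightarrow> real \<Rightarrow> 'k::{real_normed_field, euclidean_space}) \<Rightarrow> 'i \<Rightarrow> real \<Rightarrow> 'k" where
  "translate_family G t f i s = (\<Sum>\<^sub>\<infinity>j\<in>desc G (jump t s) i. f j (frac (t + s)))"

definition left_translation ::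
    "('v, 'i) pre_digraph \<Rightarrow> ('i \<Rightarrow> real \<Rightarrow> real) \<Rightarrow> real
      \<Rightarrow> ('i \<Rightarrow> real \<Rightarrow> 'k::{real_normed_field, euclidean_space}) set
      \<Rightarrow> ('i \<Rightarrow> real \<Rightarrow> 'k) set" where
  "left_translation G \<rho> t F = L1_eq G \<rho> `` {translate_family G t (rep F)}"

text \<open>
  The infima below are infima of real numbers bounded below by \<open>0\<close>. They are meant for leafless
  trees, where \<open>desc G n i\<close> is nonempty.
\<close>

definition Phi1 ::
    "('v, 'i) pre_digraph \<Rightarrow> ('i \<Rightarrow> real \<Rightarrow> real) \<Rightarrow> 'i \<Rightarrow> real \<Rightarrow> real \<Rightarrow> real" where
  "Phi1 G \<rho> i t s = (INF j\<in>desc G (jump t s) i. \<rho> j (frac (t + s)))"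

definition Psi1 ::
    "('v, 'i) pre_digraph \<Rightarrow> ('i \<Rightarrow> real \<Rightarrow> real) \<Rightarrow> 'i \<Rightarrow> real \<Rightarrow> real \<Rightarrow> real" where
  "Psi1 G \<rho> i t s =
     min (\<rho> (anc G (jump t s) i) s)
         (INF j\<in>desc G (jump t s) (anc G (jump t s) i). \<rho> j (frac (t + s)))"

definition admissible1 :: "('v, 'i) pre_digraph \<Rightarrow> ('i \<Rightarrow> real \<Rightarrow> real) \<Rightarrow> bool" where
  "admissible1 G \<rho> \<longleftrightarrow>
     (\<exists>M\<ge>1. \<exists>\<omega>. \<forall>i\<in>arcs G. \<forall>t\<ge>0. \<forall>s\<in>{0..<1}.
        \<rho> i s \<le> M * exp (\<omega> * t) * (INF j\<in>desc G (jump t s) i. \<rho> j (frac (t + s))))"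

definition N1 ::
    "('v, 'i) pre_digraph \<Rightarrow> ('i \<Rightarrow> real \<Rightarrow> real) \<Rightarrow> 'i set \<Rightarrow> real \<Rightarrow> real \<Rightarrow> real set" where
  "N1 G \<rho> K \<epsilon> \<alpha> =
     {t. t \<ge> 0 \<and>
        (INF E\<in>{E \<in> sets unit_lebesgue. measure unit_lebesgue E > \<alpha>}.
           LINT s:E|unit_lebesgue. (\<Sum>i\<in>K. Phi1 G \<rho> i t s + Psi1 G \<rho> i t s)) < \<epsilon>}"

section \<open>Furstenberg families and recurrence\<close>

definition furstenberg_family :: "real set set \<Rightarrow> bool" where
  "furstenberg_family \<F> \<longleftrightarrow> \<F> \<noteq> {} \<and> (\<forall>A\<in>\<F>. A \<subseteq> {0..}) \<and>
     (\<forall>A B. A \<in> \<F> \<and> A \<subseteq> B \<and> B \<subseteq> {0..} \<longrightarrow> B \<in> \<F>)"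

definition proper_family :: "real set set \<Rightarrow> bool" where
  "proper_family \<F> \<longleftrightarrow> {} \<notin> \<F> \<and> \<F> \<noteq> {}"

definition finite_invariant :: "real set set \<Rightarrow> bool" where
  "finite_invariant \<F> \<longleftrightarrow> (\<forall>A\<in>\<F>. \<forall>R>0. A \<inter> {R<..} \<in> \<F>)"

definition hitting_times :: "(real \<Rightarrow> 'x \<Rightarrow> 'x) \<Rightarrow> 'x set \<Rightarrow> 'x set \<Rightarrow> real set" where
  "hitting_times T U V = {t. t \<ge> 0 \<and> T t ` U \<inter> V \<noteq> {}}"

definition family_transitive ::
    "real set set \<Rightarrow> 'x topology \<Rightarrow> (real \<Rightarrow> 'x \<Rightarrow> 'x) \<Rightarrow> bool" where
  "family_transitive \<F> X T \<longleftrightarrow>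
     (\<forall>U V. openin X U \<and> U \<noteq> {} \<and> openin X V \<and> V \<noteq> {} \<longrightarrow> hitting_times T U V \<in> \<F>)"

definition family_recurrent ::
    "real set set \<Rightarrow> 'x topology \<Rightarrow> (real \<Rightarrow> 'x \<Rightarrow> 'x) \<Rightarrow> bool" where
  "family_recurrent \<F> X T \<longleftrightarrow>
     (\<forall>U. openin X U \<and> U \<noteq> {} \<longrightarrow> hitting_times T U U \<in> \<F>)"

end

theory Submission
  imports Defs
begin

text \<open>
  Only two implications need work, and both rest on pointwise estimates along the orbit
  \<open>s \<mapsto> (s, frac (t + s))\<close>, whose two coordinates preserve Lebesgue measure.
  Let \<open>S u s\<close> denote the sum of \<open>\<bar>u\<^sub>i(s)\<bar> \<rho>\<^sub>i(s)\<close> over all edges \<open>i\<close>.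

  If the semigroup is recurrent, a return of a small ball around the indicator \<open>f\<close> of \<open>K\<close> gives
  \<open>g\<close> with \<open>g\<close> and \<open>T\<^sub>t g\<close> close to \<open>f\<close>. For large \<open>t\<close> no edge of \<open>K\<close> descends from another one
  in \<open>n(t,s)\<close> generations, so \<open>f\<close> vanishes on \<open>M\<^sub>n(i)\<close> and at \<open>K\<^sub>n(i)\<close>. As the values of \<open>f\<close> on
  \<open>M\<^sub>n(K\<^sub>n(i))\<close> have a sum of modulus at least 1, one gets
  \<open>\<Psi>\<^sub>i \<le> S (T\<^sub>t g - f) s + S (g - f) (frac (t + s))\<close>, and
  \<open>\<Phi>\<^sub>i \<le> 2 S (g - f) (frac (t + s))\<close> wherever \<open>\<bar>(T\<^sub>t g)\<^sub>i - 1\<bar> \<le> 1/2\<close>, which is a set of large measure.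

  Conversely, let the integral of \<open>\<Sum>(\<Phi>\<^sub>i + \<Psi>\<^sub>i)\<close> over a large set \<open>E\<close> be small, and cut given \<open>f\<close> and
  \<open>g\<close> down to \<open>K\<close> and \<open>E\<close>. Admissibility makes \<open>\<Phi>\<^sub>k\<close> positive, so that every edge \<open>k\<close> has a
  descendant of weight at most \<open>2 \<Phi>\<^sub>k\<close>. A mass placed there produces \<open>g\<close>, and cancels the image
  \<open>T\<^sub>t f\<close> at \<open>k = K\<^sub>n(i)\<close> unless \<open>\<rho>\<^sub>k \<le> \<Phi>\<^sub>k\<close>, in which case that image is itself
  negligible: in either case the cost is of order \<open>min \<rho>\<^sub>k \<Phi>\<^sub>k = \<Psi>\<^sub>i\<close>.
\<close>

section \<open>Rootless leafless directed trees\<close>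

locale rootless_leafless_tree = directed_tree G for G :: "('v, 'i) pre_digraph" (structure) +
  assumes no_root: "\<not> (\<exists>v. is_root G v)"
    and no_leaf: "\<not> (\<exists>v. is_leaf G v)"
begin

text \<open>Without multiple arcs an edge is determined by its two endpoints, so a numbering of the
  countable vertex set injects the edges into pairs of natural numbers.\<close>

lemma countable_arcs: "countable (arcs G)"
proof (rule countableI')
  show "inj_on (\<lambda>e. (to_nat_on (verts G) (tail G e), to_nat_on (verts G) (head G e))) (arcs G)"
  proof (rule inj_onI)
    fix e1 e2 assume e: "e1 \<in> arcs G" "e2 \<in> arcs G"
      and eq: "(to_nat_on (verts G) (tail G e1), to_nat_on (verts G) (head G e1))
        = (to_nat_on (verts G) (tail G e2), to_nat_on (verts G) (head G e2))"
    have "tail G e1 = tail G e2" "head G e1 = head G e2"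
      using e eq countable_verts by auto
    then show "e1 = e2" using no_multi_arcs[OF e] by (simp add: arc_to_ends_def)
  qed
qed

lemma head_inj: "e1 \<in> arcs G \<Longrightarrow> e2 \<in> arcs G \<Longrightarrow> head G e1 = head G e2 \<Longrightarrow> e1 = e2"
  using no_multi_arcs[of e1 e2] parent_unique[of e1 e2] by (simp add: arc_to_ends_def)

text \<open>A connected graph has a vertex, and as that vertex is not a leaf, an edge starts
  there.\<close>

lemma arcs_nonempty: "arcs G \<noteq> {}"
proof -
  have "connected G" using tree by (simp add: tree_def)
  then have "verts G \<noteq> {}"
    by (auto simp: connected_def strongly_connected_def)
  then show ?thesis using no_leaf by (auto simp: is_leaf_def)
qed

section \<open>Generations of descendants and ancestors\<close>

lemma desc_in_arcs: "i \<in> arcs G \<Longrightarrow> j \<in> desc G n i \<Longrightarrow> j \<in> arcs G"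
  by (cases n) auto

text \<open>Leaflessness continues every descent by one more generation. This keeps the infima in
  \<open>Phi1\<close> and \<open>Psi1\<close> from ranging over an empty set.\<close>

lemma desc_nonempty: "i \<in> arcs G \<Longrightarrow> desc G n i \<noteq> {}"
proof (induction n)
  case (Suc n)
  then obtain k where k: "k \<in> desc G n i" "k \<in> arcs G" using desc_in_arcs by blast
  then obtain j where "j \<in> arcs G" "tail G j = head G k"
    using no_leaf head_in_verts[of k] unfolding is_leaf_def by blast
  then show ?case using k by force
qed simp

lemma ancestor_unique:
  "i \<in> arcs G \<Longrightarrow> i' \<in> arcs G \<Longrightarrow> j \<in> desc G n i \<Longrightarrow> j \<in> desc G n i' \<Longrightarrow> i = i'"
proof (induction n arbitrary: j)
  case (Suc n)
  then obtain k k' where "k \<in> desc G n i" "k' \<in> desc G n i'" "head G k = tail G j" "head G k' = tail G j"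
    by auto
  moreover from this Suc.prems have "k = k'" by (intro head_inj) (auto dest: desc_in_arcs)
  ultimately show ?case using Suc by auto
qed simp

text \<open>The parent edge \<open>p\<close> of \<open>j\<close> exists because there is no root; an
  \<open>n\<close>-th ancestor of \<open>p\<close> is an ancestor of \<open>j\<close> one generation
  further back.\<close>

lemma ancestor_exists: "j \<in> arcs G \<Longrightarrow> \<exists>k\<in>arcs G. j \<in> desc G n k"
proof (induction n arbitrary: j)
  case (Suc n)
  then obtain p where "p \<in> arcs G" "head G p = tail G j"
    using no_root tail_in_verts[of j] unfolding is_root_def by blast
  then show ?case using Suc.IH[of p] Suc.prems by auto
qed auto

lemma anc_eq: assumes "k \<in> arcs G" "j \<in> desc G n k" shows "anc G n j = k"
  unfolding anc_def using assms by (blast intro: the_equality dest: ancestor_unique)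

lemma anc_in_arcs: "j \<in> arcs G \<Longrightarrow> anc G n j \<in> arcs G"
  and in_desc_anc: "j \<in> arcs G \<Longrightarrow> j \<in> desc G n (anc G n j)"
  using ancestor_exists[of j n] anc_eq by auto

lemma in_desc_iff: "k \<in> arcs G \<Longrightarrow> j \<in> arcs G \<Longrightarrow> j \<in> desc G n k \<longleftrightarrow> anc G n j = k"
  using anc_eq in_desc_anc by blast

lemma desc_add_decompose: "j \<in> desc G (d + m) i \<Longrightarrow> \<exists>k\<in>desc G d i. j \<in> desc G m k"
  by (induction m arbitrary: j) (auto, blast)

text \<open>Links the recursive generations to directed walks, for which acyclicity is formulated.
  The walk runs from tail to tail, so it contains \<open>i\<close> but not the last edge
  \<open>j\<close>, and its length is exactly \<open>n\<close>.\<close>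

lemma desc_awalk:
  "i \<in> arcs G \<Longrightarrow> j \<in> desc G n i \<Longrightarrow> \<exists>p. awalk (tail G i) p (tail G j) \<and> length p = n"
proof (induction n arbitrary: j)
  case 0
  then show ?case by (auto intro!: exI[of _ "[]"] simp: awalk_Nil_iff)
next
  case (Suc n)
  then obtain k where k: "k \<in> desc G n i" "head G k = tail G j" "j \<in> arcs G" by auto
  with Suc obtain p where p: "awalk (tail G i) p (tail G k)" "length p = n" by blast
  have "k \<in> arcs G" using k Suc.prems desc_in_arcs by blast
  then have "awalk (tail G k) [k] (tail G j)" using k by (auto simp: awalk_Cons_iff awalk_Nil_iff)
  with p show ?case by (intro exI[of _ "p @ [k]"]) (auto intro: awalk_appendI)
qed

lemma not_own_descendant: assumes "i \<in> arcs G" "i \<in> desc G n i" shows "n = 0"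
proof (rule ccontr)
  assume "n \<noteq> 0"
  then obtain p where "awalk (tail G i) p (tail G i)" "length p > 0"
    using desc_awalk[OF assms] by auto
  then have "closed_w p" by (auto simp: closed_w_def)
  then show False using closed_w_imp_cycle tree by (auto simp: tree_def forest_def)
qed

text \<open>If \<open>j\<close> occurs at levels \<open>m\<close> and \<open>d + m\<close>, the
  longer descent passes through some \<open>k\<close> at level \<open>d\<close> having
  \<open>j\<close> as an \<open>m\<close>-th descendant. Uniqueness of ancestors forces
  \<open>k = i\<close>, and acyclicity then gives \<open>d = 0\<close>.\<close>

lemma desc_level_unique:
  assumes "i \<in> arcs G" "j \<in> desc G m i" "j \<in> desc G n i" shows "m = n"
proof -
  have *: "m = n" if le: "m \<le> n" and m: "j \<in> desc G m i" and n: "j \<in> desc G n i" for m n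
  proof -
    obtain d where d: "n = d + m" using le by (metis le_add_diff_inverse2)
    then obtain k where k: "k \<in> desc G d i" "j \<in> desc G m k" using desc_add_decompose n by blast
    then have "k = i" using ancestor_unique assms(1) m desc_in_arcs by blast
    then show ?thesis using k d not_own_descendant assms(1) by auto
  qed
  show ?thesis using *[of m n] *[of n m] assms by (cases "m \<le> n") auto
qed

text \<open>Each of the finitely many pairs from \<open>K\<close> is related in at most one
  generation, so beyond the largest of these generations no edge of \<open>K\<close> descends from
  another one.\<close>

lemma eventually_desc_disjoint:
  assumes "finite K" "K \<subseteq> arcs G"
  obtains N where "\<And>n i. n \<ge> N \<Longrightarrow> i \<in> K \<Longrightarrow> desc G n i \<inter> K = {}"
proof -
  have "finite {n. j \<in> desc G n i}" if "i \<in> K" for i j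
  proof (cases "\<exists>m. j \<in> desc G m i")
    case True
    then obtain m where "j \<in> desc G m i" by blast
    then have "{n. j \<in> desc G n i} \<subseteq> {m}" using desc_level_unique that assms(2) by blast
    then show ?thesis by (rule finite_subset) simp
  qed auto
  then have "finite (\<Union>i\<in>K. \<Union>j\<in>K. {n. j \<in> desc G n i})" using assms by auto
  then obtain N where N: "\<forall>n\<in>(\<Union>i\<in>K. \<Union>j\<in>K. {n. j \<in> desc G n i}). n < N"
    by (metis finite_nat_set_iff_bounded)
  show thesis by (rule that[of N]) (use N in fastforce)
qed

end

section \<open>Translation modulo one\<close>

lemma translation_measurable_lebesgue: "(\<lambda>x::real. c + x) \<in> lebesgue \<rightarrow>\<^sub>M lebesgue"
  using lebesgue_affine_measurable[of "\<lambda>_. 1" c] by simp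

lemma frac_translation_measurable:
  "(\<lambda>s. frac (t + s)) \<in> unit_lebesgue \<rightarrow>\<^sub>M unit_lebesgue"
proof (rule measurable_restrict_space3)
  \<comment> \<open>A Borel map need not be measurable from \<open>lebesgue\<close> to
    \<open>lebesgue\<close>. The map is therefore cut along the countably many values of the floor
    into translations, which are.\<close>
  have "(\<lambda>x::real. t - of_int \<lfloor>t + x\<rfloor> + x) \<in> lebesgue \<rightarrow>\<^sub>M lebesgue"
  proof (rule measurable_compose_countable'[where f = "\<lambda>n x. t - of_int n + x" and g = "\<lambda>x. \<lfloor>t + x\<rfloor>" and I = UNIV])
    show "(\<lambda>x. \<lfloor>t + x\<rfloor>) \<in> lebesgue \<rightarrow>\<^sub>M count_space UNIV"
      by (rule measurable_completion) measurable
  qed (auto simp: translation_measurable_lebesgue)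
  then show "(\<lambda>s. frac (t + s)) \<in> lebesgue \<rightarrow>\<^sub>M lebesgue"
    by (simp add: frac_def algebra_simps)
qed (auto simp: frac_lt_1)

lemma jump_measurable: "jump t \<in> unit_lebesgue \<rightarrow>\<^sub>M count_space UNIV"
proof -
  have "(\<lambda>s. nat \<lfloor>t + s\<rfloor>) \<in> lebesgue \<rightarrow>\<^sub>M count_space UNIV"
    by (rule measurable_completion) measurable
  then show ?thesis unfolding jump_def[abs_def] by (rule measurable_restrict_space1)
qed

lemma frac_eq_if_diff_of_int: "x = y + of_int n \<Longrightarrow> frac x = frac y" for x y :: real
  by (simp add: frac_def)

lemma frac_translation_inverse:
  fixes s t :: real
  assumes "s \<in> {0..<1}" shows "frac (- t + frac (t + s)) = s" "frac (t + frac (- t + s)) = s"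
proof -
  have "frac s = s" using assms by (simp add: frac_eq)
  moreover have "frac (- t + frac (t + s)) = frac s" "frac (t + frac (- t + s)) = frac s"
    using frac_eq_if_diff_of_int[of "- t + frac (t + s)" s "- \<lfloor>t + s\<rfloor>"]
      frac_eq_if_diff_of_int[of "t + frac (- t + s)" s "- \<lfloor>- t + s\<rfloor>"] by (simp_all add: frac_def)
  ultimately show "frac (- t + frac (t + s)) = s" "frac (t + frac (- t + s)) = s" by simp_all
qed

text \<open>With \<open>r = frac t\<close> the map exchanges two intervals: it translates
  \<open>{0..<1 - r}\<close> onto \<open>{r..<1}\<close> and \<open>{1 - r..<1}\<close> onto
  \<open>{0..<r}\<close>. Translation invariance is applied to both pieces.\<close>

lemma nn_integral_frac_translation:
  assumes "\<phi> \<in> borel_measurable unit_lebesgue"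
  shows "(\<integral>\<^sup>+s. \<phi> (frac (t + s)) \<partial>unit_lebesgue) = (\<integral>\<^sup>+s. \<phi> s \<partial>unit_lebesgue)"
proof -
  define r where "r = frac t"
  have r: "0 \<le> r" "r < 1" by (auto simp: r_def frac_lt_1)
  let ?I = "\<lambda>S s. indicator S s :: ennreal"
  have m: "(\<lambda>s. \<phi> s * ?I {0..<1} s) \<in> borel_measurable lebesgue"
    using assms by (simp add: borel_measurable_restrict_space_iff_ennreal)
  have m1: "(\<lambda>s. (\<phi> s * ?I {0..<1} s) * ?I {r..<1} s) \<in> borel_measurable lebesgue"
    "(\<lambda>s. (\<phi> s * ?I {0..<1} s) * ?I {0..<r} s) \<in> borel_measurable lebesgue"
    using m by (auto intro!: borel_measurable_times_ennreal borel_measurable_indicator)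
  have tr: "(\<integral>\<^sup>+s. \<psi> (c + s) \<partial>lebesgue) = (\<integral>\<^sup>+s. \<psi> s \<partial>lebesgue)"
    if "\<psi> \<in> borel_measurable lebesgue" for \<psi> :: "real \<Rightarrow> ennreal" and c
    using nn_integral_real_affine_lebesgue[OF that, of 1 c] by simp
  have trm: "(\<lambda>s. \<psi> (c + s)) \<in> borel_measurable lebesgue"
    if "\<psi> \<in> borel_measurable lebesgue" for \<psi> :: "real \<Rightarrow> ennreal" and c
    using measurable_compose[OF translation_measurable_lebesgue that] .
  have fr: "frac (t + s) = (if s < 1 - r then r + s else r - 1 + s)" if "s \<in> {0..<1}" for s
  proof -
    have "frac (t + s) = frac (r + s)"
      by (rule frac_eq_if_diff_of_int[where n = "\<lfloor>t\<rfloor>"]) (simp add: r_def frac_def)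
    moreover have "frac (r + s) = (if s < 1 - r then r + s else r - 1 + s)"
      using that r by (auto simp: frac_unique_iff)
    ultimately show ?thesis by simp
  qed
  have "(\<integral>\<^sup>+s. \<phi> (frac (t + s)) \<partial>unit_lebesgue) = (\<integral>\<^sup>+s. \<phi> (frac (t + s)) * ?I {0..<1} s \<partial>lebesgue)"
    by (simp add: nn_integral_restrict_space)
  also have "\<dots> = (\<integral>\<^sup>+s. (\<phi> (r + s) * ?I {0..<1} (r + s)) * ?I {r..<1} (r + s)
      + (\<phi> (r - 1 + s) * ?I {0..<1} (r - 1 + s)) * ?I {0..<r} (r - 1 + s) \<partial>lebesgue)"
    by (intro nn_integral_cong) (use r in \<open>auto simp: indicator_def fr\<close>)
  also have "\<dots> = (\<integral>\<^sup>+s. (\<phi> s * ?I {0..<1} s) * ?I {r..<1} s \<partial>lebesgue)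
      + (\<integral>\<^sup>+s. (\<phi> s * ?I {0..<1} s) * ?I {0..<r} s \<partial>lebesgue)"
    using tr[OF m1(1), of r] tr[OF m1(2), of "r - 1"] trm[OF m1(1), of r] trm[OF m1(2), of "r - 1"]
    by (subst nn_integral_add) simp_all
  also have "\<dots> = (\<integral>\<^sup>+s. (\<phi> s * ?I {0..<1} s) * ?I {r..<1} s
      + (\<phi> s * ?I {0..<1} s) * ?I {0..<r} s \<partial>lebesgue)"
    using m1 by (subst nn_integral_add) simp_all
  also have "\<dots> = (\<integral>\<^sup>+s. \<phi> s * ?I {0..<1} s \<partial>lebesgue)"
    by (intro nn_integral_cong) (use r in \<open>auto simp: indicator_def\<close>)
  also have "\<dots> = (\<integral>\<^sup>+s. \<phi> s \<partial>unit_lebesgue)"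
    by (simp add: nn_integral_restrict_space)
  finally show ?thesis .
qed

text \<open>Stated as an equality of measures, the invariance also transports null sets and Bochner
  integrability.\<close>

lemma distr_frac_translation:
  "distr unit_lebesgue unit_lebesgue (\<lambda>s. frac (t + s)) = unit_lebesgue"
proof (rule measure_eqI)
  fix A assume "A \<in> sets (distr unit_lebesgue unit_lebesgue (\<lambda>s. frac (t + s)))"
  then have A: "A \<in> sets unit_lebesgue" by simp
  have "emeasure (distr unit_lebesgue unit_lebesgue (\<lambda>s. frac (t + s))) A
      = (\<integral>\<^sup>+s. indicator A s \<partial>distr unit_lebesgue unit_lebesgue (\<lambda>s. frac (t + s)))"
    using A by simp
  also have "\<dots> = (\<integral>\<^sup>+s. indicator A (frac (t + s)) \<partial>unit_lebesgue)"
    using A frac_translation_measurable by (subst nn_integral_distr) simp_all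
  also have "\<dots> = emeasure unit_lebesgue A"
    using A by (subst nn_integral_frac_translation) simp_all
  finally show "emeasure (distr unit_lebesgue unit_lebesgue (\<lambda>s. frac (t + s))) A = emeasure unit_lebesgue A" .
qed simp

lemma AE_frac_translation:
  assumes "AE u in unit_lebesgue. P u" shows "AE s in unit_lebesgue. P (frac (t + s))"
proof -
  have "AE u in distr unit_lebesgue unit_lebesgue (\<lambda>s. frac (t + s)). P u"
    by (subst distr_frac_translation) (rule assms)
  then show ?thesis by (rule AE_distrD[OF frac_translation_measurable])
qed

lemma emeasure_unit_lebesgue_space: "emeasure unit_lebesgue {0..<1} = 1"
  by (simp add: emeasure_restrict_space)

section \<open>Sums and integrals in the extended half-line\<close>

text \<open>Passing to the counting measure makes integration theory available for
  \<open>infsum\<close>: Tonelli, constant factors and measurability in a parameter.\<close>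

lemma infsum_eq_nn_integral_count_space:
  fixes f :: "'a \<Rightarrow> ennreal"
  assumes "countable A"
  shows "infsum f A = (\<integral>\<^sup>+x. f x \<partial>count_space A)"
proof (rule antisym)
  have inf: "infsum f A = (SUP F\<in>{F. finite F \<and> F \<subseteq> A}. sum f F)"
    by (rule nonneg_infsum_complete) simp
  show "infsum f A \<le> (\<integral>\<^sup>+x. f x \<partial>count_space A)"
    unfolding inf
  proof (rule SUP_least)
    fix F assume "F \<in> {F. finite F \<and> F \<subseteq> A}"
    then have F: "finite F" "F \<subseteq> A" by auto
    have "sum f F = (\<integral>\<^sup>+x. f x * indicator F x \<partial>count_space A)"
      using F by (subst nn_integral_count_space'[of F]) (auto intro: sum.cong)
    also have "\<dots> \<le> (\<integral>\<^sup>+x. f x \<partial>count_space A)"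
      by (intro nn_integral_mono) (auto simp: indicator_def)
    finally show "sum f F \<le> (\<integral>\<^sup>+x. f x \<partial>count_space A)" .
  qed
  show "(\<integral>\<^sup>+x. f x \<partial>count_space A) \<le> infsum f A"
  proof (cases "finite A")
    case True
    then show ?thesis by (simp add: nn_integral_count_space_finite)
  next
    case False
    note bij = bij_betw_from_nat_into[OF assms False]
    have "(\<integral>\<^sup>+x. f x \<partial>count_space A) = (\<Sum>n. f (from_nat_into A n))"
      by (simp add: nn_integral_bij_count_space[symmetric, OF bij] nn_integral_count_space_nat)
    also have "\<dots> \<le> infsum f A"
    proof (rule suminf_le_const)
      fix n
      have "(\<Sum>i<n. f (from_nat_into A i)) = sum f (from_nat_into A ` {..<n})"
        using bij by (subst sum.reindex) (auto simp: bij_betw_def intro: inj_on_subset)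
      also have "\<dots> \<le> infsum f A"
        unfolding inf using bij by (intro SUP_upper) (auto simp: bij_betw_def)
      finally show "(\<Sum>i<n. f (from_nat_into A i)) \<le> infsum f A" .
    qed simp
    finally show ?thesis .
  qed
qed

lemma infsum_nn_integral_swap:
  fixes f :: "'a \<Rightarrow> 'b \<Rightarrow> ennreal"
  assumes "countable A" "\<And>i. i \<in> A \<Longrightarrow> f i \<in> borel_measurable M"
  shows "(\<Sum>\<^sub>\<infinity>i\<in>A. \<integral>\<^sup>+s. f i s \<partial>M) = (\<integral>\<^sup>+s. (\<Sum>\<^sub>\<infinity>i\<in>A. f i s) \<partial>M)"
  using assms by (simp add: infsum_eq_nn_integral_count_space nn_integral_count_space_nn_integral)

section \<open>The weighted space\<close>

locale weighted_tree = rootless_leafless_tree G for G :: "('v, 'i) pre_digraph" (structure) +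
  fixes \<rho> :: "'i \<Rightarrow> real \<Rightarrow> real"
  assumes weight: "is_weight G \<rho>"
begin

lemma weight_measurable: "i \<in> arcs G \<Longrightarrow> \<rho> i \<in> borel_measurable unit_lebesgue"
  and weight_integrable: "i \<in> arcs G \<Longrightarrow> integrable unit_lebesgue (\<rho> i)"
  and weight_pos: "i \<in> arcs G \<Longrightarrow> s \<in> {0..<1} \<Longrightarrow> \<rho> i s > 0"
  using weight by (auto simp: is_weight_def)

text \<open>This is the quantity \<open>S f s\<close> of the overview. It collects all edges at one
  coordinate, so that norms become integrals over a single variable, to which the rotation
  applies.\<close>

definition mass :: "('i \<Rightarrow> real \<Rightarrow> 'k::real_normed_field) \<Rightarrow> real \<Rightarrow> ennreal" where
  "mass f s = (\<Sum>\<^sub>\<infinity>i\<in>arcs G. ennreal (norm (f i s) * \<rho> i s))"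

definition measurable_family :: "('i \<Rightarrow> real \<Rightarrow> 'k::{real_normed_field, euclidean_space}) \<Rightarrow> bool" where
  "measurable_family f \<longleftrightarrow> (\<forall>i\<in>arcs G. f i \<in> borel_measurable unit_lebesgue)"

lemma integrand_measurable:
  assumes "measurable_family f" "i \<in> arcs G"
  shows "(\<lambda>s. ennreal (norm (f i s) * \<rho> i s)) \<in> borel_measurable unit_lebesgue"
proof -
  have [measurable]: "f i \<in> borel_measurable unit_lebesgue" "\<rho> i \<in> borel_measurable unit_lebesgue"
    using assms weight_measurable by (auto simp: measurable_family_def)
  show ?thesis by measurable
qed

lemma measurable_family_diff:
  "measurable_family f \<Longrightarrow> measurable_family g \<Longrightarrow> measurable_family (\<lambda>i s. f i s - g i s)"
  by (simp add: measurable_family_def borel_measurable_diff)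

lemma mass_measurable:
  assumes "measurable_family f" shows "mass f \<in> borel_measurable unit_lebesgue"
proof -
  have "(\<lambda>s. \<integral>\<^sup>+i. ennreal (norm (f i s) * \<rho> i s) \<partial>count_space (arcs G)) \<in> borel_measurable unit_lebesgue"
  proof (cases "finite (arcs G)")
    case True
    then show ?thesis
      using integrand_measurable[OF assms] by (simp add: nn_integral_count_space_finite)
  next
    case False
    have in_arcs: "from_nat_into (arcs G) n \<in> arcs G" for n using arcs_nonempty by (rule from_nat_into)
    have "(\<lambda>s. \<Sum>n. ennreal (norm (f (from_nat_into (arcs G) n) s) * \<rho> (from_nat_into (arcs G) n) s))
        \<in> borel_measurable unit_lebesgue"
      by (intro borel_measurable_suminf_order integrand_measurable assms in_arcs)
    then show ?thesis
      by (simp add: nn_integral_bij_count_space[symmetric, OF bij_betw_from_nat_into[OF countable_arcs False]]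
          nn_integral_count_space_nat)
  qed
  then show ?thesis
    by (simp add: mass_def[abs_def] infsum_eq_nn_integral_count_space[OF countable_arcs])
qed

lemma L1_norm_eq_integral_mass:
  "measurable_family f \<Longrightarrow> L1_norm G \<rho> f = (\<integral>\<^sup>+s. mass f s \<partial>unit_lebesgue)"
  unfolding L1_norm_def mass_def
  by (intro infsum_nn_integral_swap countable_arcs) (rule integrand_measurable)

lemma L1_families_iff: "f \<in> L1_families G \<rho> \<longleftrightarrow> measurable_family f \<and> L1_norm G \<rho> f < \<infinity>"
  by (simp add: L1_families_def measurable_family_def)

lemma L1_norm_mono:
  fixes f :: "'i \<Rightarrow> real \<Rightarrow> 'k::real_normed_field" and g :: "'i \<Rightarrow> real \<Rightarrow> 'l::real_normed_field"
  assumes "\<And>i. i \<in> arcs G \<Longrightarrow> AE s in unit_lebesgue. norm (f i s) \<le> norm (g i s)"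
  shows "L1_norm G \<rho> f \<le> L1_norm G \<rho> g"
  unfolding L1_norm_def
proof (intro infsum_mono nn_integral_mono_AE)
  fix i assume i: "i \<in> arcs G"
  show "AE s in unit_lebesgue. ennreal (norm (f i s) * \<rho> i s) \<le> ennreal (norm (g i s) * \<rho> i s)"
    using assms[OF i] AE_space
    by eventually_elim (use weight_pos[OF i] in \<open>force intro!: ennreal_leI mult_right_mono\<close>)
qed (simp_all add: nonneg_summable_on_complete)

lemma L1_norm_cong_AE:
  fixes f g :: "'i \<Rightarrow> real \<Rightarrow> 'k::real_normed_field"
  assumes "\<And>i. i \<in> arcs G \<Longrightarrow> AE s in unit_lebesgue. f i s = g i s"
  shows "L1_norm G \<rho> f = L1_norm G \<rho> g"
proof (rule antisym)
  show "L1_norm G \<rho> f \<le> L1_norm G \<rho> g"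
    by (rule L1_norm_mono, rule eventually_mono[OF assms]) auto
  show "L1_norm G \<rho> g \<le> L1_norm G \<rho> f"
    by (rule L1_norm_mono, rule eventually_mono[OF assms]) auto
qed

lemma mass_triangle:
  assumes "s \<in> {0..<1}" "\<And>i. i \<in> arcs G \<Longrightarrow> norm (h i s) \<le> norm (f i s) + norm (g i s)"
  shows "mass h s \<le> mass f s + mass g s"
proof -
  have "mass h s \<le> (\<Sum>\<^sub>\<infinity>i\<in>arcs G. ennreal (norm (f i s) * \<rho> i s) + ennreal (norm (g i s) * \<rho> i s))"
    unfolding mass_def
  proof (rule infsum_mono)
    fix i assume i: "i \<in> arcs G"
    have "norm (h i s) * \<rho> i s \<le> norm (f i s) * \<rho> i s + norm (g i s) * \<rho> i s"
      using mult_right_mono[OF assms(2)[OF i], of "\<rho> i s"] weight_pos[OF i assms(1)]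
      by (simp add: distrib_right)
    then show "ennreal (norm (h i s) * \<rho> i s) \<le> ennreal (norm (f i s) * \<rho> i s) + ennreal (norm (g i s) * \<rho> i s)"
      using weight_pos[OF i assms(1)] by (simp flip: ennreal_plus)
  qed (simp_all add: nonneg_summable_on_complete)
  also have "\<dots> = mass f s + mass g s"
    unfolding mass_def by (rule infsum_add) (simp_all add: nonneg_summable_on_complete)
  finally show ?thesis .
qed

lemma L1_norm_triangle:
  assumes "measurable_family f" "measurable_family g" "measurable_family h"
    and "\<And>i s. i \<in> arcs G \<Longrightarrow> s \<in> {0..<1} \<Longrightarrow> norm (h i s) \<le> norm (f i s) + norm (g i s)"
  shows "L1_norm G \<rho> h \<le> L1_norm G \<rho> f + L1_norm G \<rho> g"
proof -
  have "(\<integral>\<^sup>+s. mass h s \<partial>unit_lebesgue) \<le> (\<integral>\<^sup>+s. mass f s + mass g s \<partial>unit_lebesgue)"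
    by (intro nn_integral_mono mass_triangle) (auto intro: assms(4))
  then show ?thesis
    using assms(1-3) by (simp add: L1_norm_eq_integral_mass nn_integral_add mass_measurable)
qed

lemma L1_norm_minus_commute:
  "L1_norm G \<rho> (\<lambda>i s. f i s - g i s) = L1_norm G \<rho> (\<lambda>i s. g i s - f i s)"
  unfolding L1_norm_def by (simp add: norm_minus_commute)

lemma L1_families_diff:
  assumes "f \<in> L1_families G \<rho>" "g \<in> L1_families G \<rho>"
  shows "(\<lambda>i s. f i s - g i s) \<in> L1_families G \<rho>"
proof -
  have "L1_norm G \<rho> (\<lambda>i s. f i s - g i s) \<le> L1_norm G \<rho> f + L1_norm G \<rho> g"
    using assms by (intro L1_norm_triangle) (auto simp: L1_families_iff measurable_family_diff norm_triangle_ineq4)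
  also have "\<dots> < \<infinity>" using assms by (simp add: L1_families_iff)
  finally show ?thesis using assms by (simp add: L1_families_iff measurable_family_diff)
qed

lemma L1_norm_diff_triangle:
  assumes "measurable_family f" "measurable_family g" "measurable_family h"
  shows "L1_norm G \<rho> (\<lambda>i s. f i s - h i s)
    \<le> L1_norm G \<rho> (\<lambda>i s. f i s - g i s) + L1_norm G \<rho> (\<lambda>i s. g i s - h i s)"
  using assms by (intro L1_norm_triangle measurable_family_diff) (auto intro: norm_diff_triangle_le)

text \<open>Strict positivity of the weights lets a vanishing weighted integral be read as vanishing
  almost everywhere.\<close>

lemma L1_norm_eq_0_imp:
  assumes "measurable_family f" "L1_norm G \<rho> f = 0" "i \<in> arcs G"
  shows "AE s in unit_lebesgue. f i s = 0"
proof -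
  have "(\<integral>\<^sup>+s. ennreal (norm (f i s) * \<rho> i s) \<partial>unit_lebesgue)
      = (\<Sum>\<^sub>\<infinity>j\<in>{i}. \<integral>\<^sup>+s. ennreal (norm (f j s) * \<rho> j s) \<partial>unit_lebesgue)" by simp
  also have "\<dots> \<le> L1_norm G \<rho> f"
    unfolding L1_norm_def by (intro infsum_mono_neutral) (use assms in \<open>auto intro: nonneg_summable_on_complete\<close>)
  finally have "(\<integral>\<^sup>+s. ennreal (norm (f i s) * \<rho> i s) \<partial>unit_lebesgue) = 0" using assms by simp
  then have "AE s in unit_lebesgue. ennreal (norm (f i s) * \<rho> i s) = 0"
    using integrand_measurable[OF assms(1,3)] by (simp add: nn_integral_0_iff_AE)
  then show ?thesis
    using AE_space
    by eventually_elim (use weight_pos[OF assms(3)] in \<open>force simp: ennreal_eq_0_iff mult_le_0_iff\<close>)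
qed

section \<open>The space of classes as a metric space\<close>

lemma equiv_L1_eq:
  "equiv (L1_families G \<rho> :: ('i \<Rightarrow> real \<Rightarrow> 'k::{real_normed_field, euclidean_space}) set) (L1_eq G \<rho>)"
proof (rule equivI)
  show "sym (L1_eq G \<rho> :: (('i \<Rightarrow> real \<Rightarrow> 'k) \<times> _) set)"
  proof (rule symI)
    fix f g :: "'i \<Rightarrow> real \<Rightarrow> 'k" assume "(f, g) \<in> L1_eq G \<rho>"
    then show "(g, f) \<in> L1_eq G \<rho>" by (auto simp: L1_eq_def eq_commute[of "g _ _"])
  qed
  show "trans (L1_eq G \<rho> :: (('i \<Rightarrow> real \<Rightarrow> 'k) \<times> _) set)"
  proof (rule transI)
    fix f g h :: "'i \<Rightarrow> real \<Rightarrow> 'k" assume a: "(f, g) \<in> L1_eq G \<rho>" "(g, h) \<in> L1_eq G \<rho>"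
    have "AE s in unit_lebesgue. f i s = h i s" if "i \<in> arcs G" for i
    proof -
      have "AE s in unit_lebesgue. f i s = g i s" "AE s in unit_lebesgue. g i s = h i s"
        using a that by (auto simp: L1_eq_def)
      then show ?thesis by eventually_elim simp
    qed
    then show "(f, h) \<in> L1_eq G \<rho>" using a by (auto simp: L1_eq_def)
  qed
  show "refl_on (L1_families G \<rho>) (L1_eq G \<rho> :: (('i \<Rightarrow> real \<Rightarrow> 'k) \<times> _) set)"
    by (simp add: L1_eq_def refl_on_def)
  show "L1_eq G \<rho> \<subseteq> (L1_families G \<rho> :: ('i \<Rightarrow> real \<Rightarrow> 'k) set) \<times> L1_families G \<rho>"
    by (auto simp: L1_eq_def)
qed

lemma class_in_L1_space: "f \<in> L1_families G \<rho> \<Longrightarrow> L1_eq G \<rho> `` {f} \<in> L1_space G \<rho>"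
  unfolding L1_space_def by (rule quotientI)

lemma
  fixes F :: "('i \<Rightarrow> real \<Rightarrow> 'k::{real_normed_field, euclidean_space}) set"
  assumes "F \<in> L1_space G \<rho>"
  shows rep_in_L1_families: "rep F \<in> L1_families G \<rho>"
    and class_rep: "L1_eq G \<rho> `` {rep F} = F"
proof -
  obtain f where f: "f \<in> L1_families G \<rho>" "F = L1_eq G \<rho> `` {f}"
    using assms unfolding L1_space_def by (rule quotientE)
  then have "rep F \<in> F"
    unfolding rep_def by (metis equiv_L1_eq equiv_class_self someI)
  then have "(f, rep F) \<in> L1_eq G \<rho>" using f by auto
  then show "rep F \<in> L1_families G \<rho>" by (simp add: L1_eq_def)
  show "L1_eq G \<rho> `` {rep F} = F"
    using equiv_class_eq[OF equiv_L1_eq \<open>(f, rep F) \<in> L1_eq G \<rho>\<close>] f(2) by simp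
qed

lemma rep_class_AE:
  fixes f :: "'i \<Rightarrow> real \<Rightarrow> 'k::{real_normed_field, euclidean_space}"
  assumes "f \<in> L1_families G \<rho>" "i \<in> arcs G"
  shows "AE s in unit_lebesgue. rep (L1_eq G \<rho> `` {f}) i s = f i s"
proof -
  let ?F = "L1_eq G \<rho> `` {f}"
  have "L1_eq G \<rho> `` {rep ?F} = ?F" using class_rep class_in_L1_space assms by blast
  then have "(rep ?F, f) \<in> L1_eq G \<rho>"
    by (metis assms(1) equiv_L1_eq eq_equiv_class)
  then show ?thesis using assms by (auto simp: L1_eq_def)
qed

text \<open>\<open>L1_dist\<close> is computed on chosen representatives; these differ from the
  given members only on null sets, which the norm does not see.\<close>

lemma L1_dist_class:
  fixes f g :: "'i \<Rightarrow> real \<Rightarrow> 'k::{real_normed_field, euclidean_space}"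
  assumes "f \<in> L1_families G \<rho>" "g \<in> L1_families G \<rho>"
  shows "L1_dist G \<rho> (L1_eq G \<rho> `` {f}) (L1_eq G \<rho> `` {g}) = enn2real (L1_norm G \<rho> (\<lambda>i s. f i s - g i s))"
  unfolding L1_dist_def
proof (rule arg_cong[of _ _ enn2real], rule L1_norm_cong_AE)
  fix i assume "i \<in> arcs G"
  from rep_class_AE[OF assms(1) this] rep_class_AE[OF assms(2) this]
  show "AE s in unit_lebesgue. rep (L1_eq G \<rho> `` {f}) i s - rep (L1_eq G \<rho> `` {g}) i s = f i s - g i s"
    by eventually_elim simp
qed

lemma Metric_space_L1:
  "Metric_space (L1_space G \<rho> :: ('i \<Rightarrow> real \<Rightarrow> 'k::{real_normed_field, euclidean_space}) set set) (L1_dist G \<rho>)"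
proof
  fix F H J :: "('i \<Rightarrow> real \<Rightarrow> 'k) set"
  show "0 \<le> L1_dist G \<rho> F H" by (simp add: L1_dist_def)
  show "L1_dist G \<rho> F H = L1_dist G \<rho> H F"
    unfolding L1_dist_def by (subst L1_norm_minus_commute) simp
  assume F: "F \<in> L1_space G \<rho>" and H: "H \<in> L1_space G \<rho>"
  have fam: "rep F \<in> L1_families G \<rho>" "rep H \<in> L1_families G \<rho>"
    using F H rep_in_L1_families by auto
  \<comment> \<open>\<open>enn2real\<close> sends infinity to \<open>0\<close>, so both the
    separation axiom and the triangle inequality rest on this finiteness.\<close>
  have fin: "L1_norm G \<rho> (\<lambda>i s. f i s - g i s) < \<infinity>"
    if "f \<in> L1_families G \<rho>" "g \<in> L1_families G \<rho>" for f g :: "'i \<Rightarrow> real \<Rightarrow> 'k"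
    using L1_families_diff[OF that] L1_families_iff by blast
  show "L1_dist G \<rho> F H = 0 \<longleftrightarrow> F = H"
  proof
    assume "L1_dist G \<rho> F H = 0"
    then have "L1_norm G \<rho> (\<lambda>i s. rep F i s - rep H i s) = 0"
      using fin[OF fam] by (auto simp: L1_dist_def enn2real_eq_0_iff)
    then have "AE s in unit_lebesgue. rep F i s = rep H i s" if "i \<in> arcs G" for i
      using L1_norm_eq_0_imp[OF measurable_family_diff _ that, of "rep F" "rep H"] fam
      by (simp add: L1_families_iff)
    then have "(rep F, rep H) \<in> L1_eq G \<rho>" using fam by (auto simp: L1_eq_def)
    then show "F = H" using class_rep F H equiv_class_eq[OF equiv_L1_eq] by metis
  qed (simp add: L1_dist_def L1_norm_def)
  assume J: "J \<in> L1_space G \<rho>"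
  have famJ: "rep J \<in> L1_families G \<rho>" using J rep_in_L1_families by auto
  have "L1_norm G \<rho> (\<lambda>i s. rep F i s - rep J i s)
    \<le> L1_norm G \<rho> (\<lambda>i s. rep F i s - rep H i s) + L1_norm G \<rho> (\<lambda>i s. rep H i s - rep J i s)"
    using fam famJ by (intro L1_norm_diff_triangle) (auto simp: L1_families_iff)
  then have "enn2real (L1_norm G \<rho> (\<lambda>i s. rep F i s - rep J i s))
    \<le> enn2real (L1_norm G \<rho> (\<lambda>i s. rep F i s - rep H i s) + L1_norm G \<rho> (\<lambda>i s. rep H i s - rep J i s))"
    using fin[OF fam] fin[OF fam(2) famJ] by (intro enn2real_mono) auto
  then show "L1_dist G \<rho> F J \<le> L1_dist G \<rho> F H + L1_dist G \<rho> H J"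
    using fin[OF fam] fin[OF fam(2) famJ] by (simp add: L1_dist_def enn2real_plus)
qed

text \<open>The ball is taken at the level of families, around the representative of a point of
  \<open>U\<close>, so that membership in \<open>U\<close> follows from a norm estimate between
  families.\<close>

lemma openin_L1_ball:
  fixes U :: "('i \<Rightarrow> real \<Rightarrow> 'k::{real_normed_field, euclidean_space}) set set"
  assumes "openin (L1_topology G \<rho>) U" "U \<noteq> {}"
  obtains f \<delta> where "f \<in> L1_families G \<rho>" "\<delta> > 0"
    "\<And>h. h \<in> L1_families G \<rho> \<Longrightarrow> L1_norm G \<rho> (\<lambda>i s. f i s - h i s) < ennreal \<delta> \<Longrightarrow> L1_eq G \<rho> `` {h} \<in> U"
proof -
  interpret Metric_space "L1_space G \<rho> :: ('i \<Rightarrow> real \<Rightarrow> 'k) set set" "L1_dist G \<rho>"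
    by (rule Metric_space_L1)
  obtain F where F: "F \<in> U" using assms by blast
  have "openin mtopology U" using assms by (simp add: L1_topology_def)
  then obtain \<delta> where \<delta>: "U \<subseteq> L1_space G \<rho>" "\<delta> > 0" "mball F \<delta> \<subseteq> U"
    using F by (auto simp: openin_mtopology)
  then have FL: "F \<in> L1_space G \<rho>" using F by blast
  show thesis
  proof (rule that[of "rep F" \<delta>])
    show f: "rep F \<in> L1_families G \<rho>" using FL by (rule rep_in_L1_families)
    fix h :: "'i \<Rightarrow> real \<Rightarrow> 'k"
    assume h: "h \<in> L1_families G \<rho>" "L1_norm G \<rho> (\<lambda>i s. rep F i s - h i s) < ennreal \<delta>"
    have "L1_dist G \<rho> F (L1_eq G \<rho> `` {h}) = enn2real (L1_norm G \<rho> (\<lambda>i s. rep F i s - h i s))"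
      using L1_dist_class[OF f h(1)] class_rep[OF FL] by simp
    also have "\<dots> < \<delta>" using h(2)
      by (cases "L1_norm G \<rho> (\<lambda>i s. rep F i s - h i s)") (auto simp: ennreal_less_iff)
    finally show "L1_eq G \<rho> `` {h} \<in> U"
      using \<delta> FL class_in_L1_space[OF h(1)] by (auto simp: mball_def)
  qed (rule \<delta>)
qed

end

section \<open>Recurrence implies the weight condition\<close>

lemma finite_sum_le_infsum_ennreal:
  fixes f :: "'a \<Rightarrow> ennreal"
  assumes "finite F" "F \<subseteq> A" shows "sum f F \<le> infsum f A"
  unfolding nonneg_infsum_complete[of A f, OF zero_le] using assms by (intro SUP_upper) auto

text \<open>If \<open>x\<close> is not summable, \<open>infsum x A\<close> is \<open>0\<close> by
  convention and the bound is trivial; otherwise it is a limit of finite triangle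
  inequalities.\<close>

lemma norm_infsum_le_ennreal:
  fixes x :: "'a \<Rightarrow> 'k::real_normed_vector"
  shows "ennreal (norm (infsum x A)) \<le> (\<Sum>\<^sub>\<infinity>j\<in>A. ennreal (norm (x j)))"
proof (cases "x summable_on A")
  case True
  then have "(sum x \<longlongrightarrow> infsum x A) (finite_subsets_at_top A)"
    using infsum_tendsto by blast
  then have "((\<lambda>F. ennreal (norm (sum x F))) \<longlongrightarrow> ennreal (norm (infsum x A))) (finite_subsets_at_top A)"
    by (intro tendsto_ennrealI tendsto_norm)
  then show ?thesis
  proof (rule tendsto_upperbound)
    have "ennreal (norm (sum x F)) \<le> (\<Sum>\<^sub>\<infinity>j\<in>A. ennreal (norm (x j)))" if "finite F" "F \<subseteq> A" for F
    proof -
      have "ennreal (norm (sum x F)) \<le> (\<Sum>j\<in>F. ennreal (norm (x j)))"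
        by (simp add: ennreal_leI norm_sum)
      also have "\<dots> \<le> (\<Sum>\<^sub>\<infinity>j\<in>A. ennreal (norm (x j)))"
        using that by (rule finite_sum_le_infsum_ennreal)
      finally show ?thesis .
    qed
    then show "\<forall>\<^sub>F F in finite_subsets_at_top A. ennreal (norm (sum x F)) \<le> (\<Sum>\<^sub>\<infinity>j\<in>A. ennreal (norm (x j)))"
      by (intro eventually_finite_subsets_at_top_weakI)
  qed simp
qed (simp add: infsum_not_exists)

lemma summable_if_infsum_norm_finite:
  fixes x :: "'a \<Rightarrow> 'k::banach"
  assumes "(\<Sum>\<^sub>\<infinity>j\<in>A. ennreal (norm (x j))) < \<infinity>"
  shows "x summable_on A"
proof (rule abs_summable_summable)
  let ?R = "\<Sum>\<^sub>\<infinity>j\<in>A. ennreal (norm (x j))"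
  show "(\<lambda>j. norm (x j)) summable_on A"
  proof (rule nonneg_bdd_above_summable_on)
    have "sum (\<lambda>j. norm (x j)) F \<le> enn2real ?R" if "finite F" "F \<subseteq> A" for F
    proof -
      have "ennreal (sum (\<lambda>j. norm (x j)) F) = (\<Sum>j\<in>F. ennreal (norm (x j)))" by simp
      also have "\<dots> \<le> ?R"
        using that by (rule finite_sum_le_infsum_ennreal)
      also have "\<dots> = ennreal (enn2real ?R)" using assms by simp
      finally show ?thesis by (simp add: ennreal_le_iff)
    qed
    then show "bdd_above (sum (\<lambda>j. norm (x j)) ` {F. F \<subseteq> A \<and> finite F})"
      by (auto simp: bdd_above_def)
  qed simp
qed

text \<open>The family \<open>x\<close> is supported in \<open>F\<close>, and \<open>y\<close> is a
  perturbation of it. If the total deviation is infinite the bound is trivial; otherwise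
  \<open>y - x\<close> is summable and \<open>y = x + (y - x)\<close> may be summed
  termwise.\<close>

lemma norm_sum_le_infsum_deviation:
  fixes x y :: "'a \<Rightarrow> 'k::banach"
  assumes "finite F" "F \<subseteq> A" "\<And>j. j \<in> A - F \<Longrightarrow> x j = 0"
  shows "ennreal (norm (sum x F))
    \<le> ennreal (norm (infsum y A)) + (\<Sum>\<^sub>\<infinity>j\<in>A. ennreal (norm (y j - x j)))"
proof (cases "(\<Sum>\<^sub>\<infinity>j\<in>A. ennreal (norm (y j - x j))) < \<infinity>")
  case True
  then have d: "(\<lambda>j. y j - x j) summable_on A" by (rule summable_if_infsum_norm_finite)
  have x: "(x has_sum sum x F) A"
    using has_sum_finite[OF assms(1), of x] assms by (subst has_sum_cong_neutral[of F A x x]) auto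
  then have xs: "x summable_on A" and xi: "infsum x A = sum x F"
    by (auto simp: has_sum_imp_summable infsumI)
  have "infsum y A = infsum (\<lambda>j. x j + (y j - x j)) A" by simp
  also have "\<dots> = sum x F + infsum (\<lambda>j. y j - x j) A"
    using infsum_add[OF xs d] xi by simp
  finally have "sum x F = infsum y A - infsum (\<lambda>j. y j - x j) A" by simp
  then have "norm (sum x F) \<le> norm (infsum y A) + norm (infsum (\<lambda>j. y j - x j) A)"
    by (simp add: norm_triangle_ineq4)
  then have "ennreal (norm (sum x F)) \<le> ennreal (norm (infsum y A)) + ennreal (norm (infsum (\<lambda>j. y j - x j) A))"
    by (simp flip: ennreal_plus)
  also have "\<dots> \<le> ennreal (norm (infsum y A)) + (\<Sum>\<^sub>\<infinity>j\<in>A. ennreal (norm (y j - x j)))"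
    by (intro add_left_mono norm_infsum_le_ennreal)
  finally show ?thesis .
next
  case False
  then show ?thesis by (simp add: not_less top_unique)
qed

text \<open>A non-integrable \<open>f\<close> has Bochner integral \<open>0\<close> by convention,
  and \<open>0 \<le> b\<close> covers this case.\<close>

lemma integral_le_if_nn_integral_le:
  assumes "\<And>x. x \<in> space M \<Longrightarrow> 0 \<le> f x" "(\<integral>\<^sup>+x. ennreal (f x) \<partial>M) \<le> ennreal b" "0 \<le> b"
  shows "integral\<^sup>L M f \<le> b"
proof (cases "integrable M f")
  case True
  then have "ennreal (integral\<^sup>L M f) = (\<integral>\<^sup>+x. ennreal (f x) \<partial>M)"
    using assms(1) by (subst nn_integral_eq_integral) auto
  then have "ennreal (integral\<^sup>L M f) \<le> ennreal b" using assms(2) by simp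
  then show ?thesis using assms(3) by (simp add: ennreal_le_iff)
qed (simp add: not_integrable_integral_eq assms(3))

context weighted_tree
begin

section \<open>Pointwise bounds for \<Phi> and \<Psi> by the deviations of a returning
  family\<close>

lemma frac_in_unit: "frac x \<in> {0..<1::real}"
  by (simp add: frac_lt_1)

lemma bdd_below_weights:
  assumes "k \<in> arcs G" "u \<in> {0..<1}" shows "bdd_below ((\<lambda>j. \<rho> j u) ` desc G n k)"
  using assms weight_pos[of _ u] desc_in_arcs[of k] by (intro bdd_belowI[of _ 0]) (auto simp: less_imp_le)

lemma INF_weights_nonneg:
  assumes "k \<in> arcs G" "u \<in> {0..<1}" shows "0 \<le> (INF j\<in>desc G n k. \<rho> j u)"
  using assms weight_pos[of _ u] desc_in_arcs[of k] desc_nonempty[of k]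
  by (intro cINF_greatest) (auto simp: less_imp_le)

lemma Phi1_nonneg: "i \<in> arcs G \<Longrightarrow> 0 \<le> Phi1 G \<rho> i t s"
  unfolding Phi1_def by (intro INF_weights_nonneg frac_in_unit)

lemma Psi1_nonneg: "i \<in> arcs G \<Longrightarrow> s \<in> {0..<1} \<Longrightarrow> 0 \<le> Psi1 G \<rho> i t s"
  unfolding Psi1_def
  using weight_pos[of "anc G (jump t s) i" s] INF_weights_nonneg[OF _ frac_in_unit] anc_in_arcs[of i] by simp

text \<open>Every descendant in the sum has weight at least \<open>c\<close> at \<open>u\<close>, so
  the sum with constant factor \<open>c\<close> is dominated by a part of the weighted sum over all
  edges.\<close>

lemma infsum_desc_le_mass:
  fixes h :: "'i \<Rightarrow> real \<Rightarrow> 'k::real_normed_field"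
  assumes "k \<in> arcs G" "u \<in> {0..<1}" "0 \<le> c" "c \<le> (INF j\<in>desc G n k. \<rho> j u)"
  shows "ennreal c * (\<Sum>\<^sub>\<infinity>j\<in>desc G n k. ennreal (norm (h j u))) \<le> mass h u"
proof -
  have D: "desc G n k \<subseteq> arcs G" using desc_in_arcs assms(1) by blast
  then have cD: "countable (desc G n k)" using countable_arcs countable_subset by blast
  have "ennreal c * (\<Sum>\<^sub>\<infinity>j\<in>desc G n k. ennreal (norm (h j u)))
      = (\<Sum>\<^sub>\<infinity>j\<in>desc G n k. ennreal c * ennreal (norm (h j u)))"
    by (simp add: infsum_eq_nn_integral_count_space[OF cD] nn_integral_cmult)
  also have "\<dots> \<le> mass h u"
    unfolding mass_def
  proof (rule infsum_mono_neutral)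
    fix j assume "j \<in> desc G n k \<inter> arcs G"
    then have "c \<le> \<rho> j u"
      using assms(4) cINF_lower[OF bdd_below_weights[OF assms(1,2)]] by (meson IntD1 order_trans)
    then show "ennreal c * ennreal (norm (h j u)) \<le> ennreal (norm (h j u) * \<rho> j u)"
      using assms(3) by (simp add: ennreal_mult[symmetric] mult.commute[of c] mult_left_mono)
  qed (use D in \<open>auto intro: nonneg_summable_on_complete\<close>)
  finally show ?thesis .
qed

lemma term_le_mass: "i \<in> arcs G \<Longrightarrow> ennreal (norm (h i s) * \<rho> i s) \<le> mass h s"
  unfolding mass_def
  using finite_sum_le_infsum_ennreal[of "{i}" "arcs G" "\<lambda>i. ennreal (norm (h i s) * \<rho> i s)"] by simp

definition indicator_family :: "'i set \<Rightarrow> 'i \<Rightarrow> real \<Rightarrow> 'k::real_normed_field" where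
  "indicator_family K i s = (if i \<in> K then 1 else 0)"

text \<open>Let \<open>k\<close> be the \<open>n\<close>-th ancestor of \<open>i\<close>. The values
  of the indicator on the descendants of \<open>k\<close> add up to at least 1. This total either
  appears in the translate at \<open>k\<close>, where the indicator vanishes and the weight is
  \<open>\<rho> k s\<close>, or is lost to deviations of \<open>g\<close> on the descendants. Both
  weights are at least \<Psi>.\<close>

lemma Psi1_le_mass:
  fixes g :: "'i \<Rightarrow> real \<Rightarrow> 'k::{real_normed_field, euclidean_space}"
  assumes K: "finite K" "K \<subseteq> arcs G" "i \<in> K" and s: "s \<in> {0..<1}"
    and disj: "\<And>i. i \<in> K \<Longrightarrow> desc G (jump t s) i \<inter> K = {}"
  shows "ennreal (Psi1 G \<rho> i t s)
    \<le> mass (\<lambda>i s. translate_family G t g i s - indicator_family K i s) s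
      + mass (\<lambda>i s. g i s - indicator_family K i s) (frac (t + s))"
proof -
  let ?n = "jump t s" and ?u = "frac (t + s)"
  let ?k = "anc G ?n i"
  let ?D = "desc G ?n ?k"
  let ?f = "indicator_family K :: 'i \<Rightarrow> real \<Rightarrow> 'k"
  let ?R = "\<Sum>\<^sub>\<infinity>j\<in>?D. ennreal (norm (g j ?u - ?f j ?u))"
  let ?P = "Psi1 G \<rho> i t s"
  have i: "i \<in> arcs G" using K by blast
  then have k: "?k \<in> arcs G" "i \<in> ?D" by (auto intro: anc_in_arcs in_desc_anc)
  \<comment> \<open>Otherwise \<open>i\<close> itself would be an edge of \<open>K\<close> among the
    descendants of an edge of \<open>K\<close>.\<close>
  have kK: "?k \<notin> K" using disj[of ?k] k K by blast
  have P0: "0 \<le> ?P" using Psi1_nonneg i s by blast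
  have "(\<Sum>j\<in>?D \<inter> K. ?f j ?u) = of_nat (card (?D \<inter> K))"
    by (simp add: indicator_family_def)
  then have "norm (\<Sum>j\<in>?D \<inter> K. ?f j ?u) = real (card (?D \<inter> K))" by (simp only: norm_of_nat)
  moreover have "card (?D \<inter> K) \<ge> 1" using k K by (auto simp: Suc_le_eq card_gt_0_iff)
  ultimately have "1 \<le> ennreal (norm (\<Sum>j\<in>?D \<inter> K. ?f j ?u))" by simp
  also have "\<dots> \<le> ennreal (norm (translate_family G t g ?k s)) + ?R"
    unfolding translate_family_def using K
    by (intro norm_sum_le_infsum_deviation) (auto simp: indicator_family_def)
  finally have "ennreal ?P * 1 \<le> ennreal ?P * (ennreal (norm (translate_family G t g ?k s)) + ?R)"
    by (rule mult_left_mono) simp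
  then have "ennreal ?P \<le> ennreal ?P * ennreal (norm (translate_family G t g ?k s)) + ennreal ?P * ?R"
    by (simp add: distrib_left)
  also have "\<dots> \<le> mass (\<lambda>i s. translate_family G t g i s - ?f i s) s + mass (\<lambda>i s. g i s - ?f i s) ?u"
  proof (rule add_mono)
    have "?P \<le> \<rho> ?k s" by (simp add: Psi1_def)
    then have "?P * norm (translate_family G t g ?k s) \<le> norm (translate_family G t g ?k s - ?f ?k s) * \<rho> ?k s"
      using kK by (simp add: indicator_family_def mult.commute[of ?P] mult_left_mono)
    then have "ennreal ?P * ennreal (norm (translate_family G t g ?k s))
        \<le> ennreal (norm (translate_family G t g ?k s - ?f ?k s) * \<rho> ?k s)"
      using P0 by (simp add: ennreal_mult[symmetric] ennreal_leI)
    also have "\<dots> \<le> mass (\<lambda>i s. translate_family G t g i s - ?f i s) s"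
      using term_le_mass[OF k(1), of "\<lambda>i s. translate_family G t g i s - ?f i s" s] by simp
    finally show "ennreal ?P * ennreal (norm (translate_family G t g ?k s))
      \<le> mass (\<lambda>i s. translate_family G t g i s - ?f i s) s" .
    show "ennreal ?P * ?R \<le> mass (\<lambda>i s. g i s - ?f i s) ?u"
      by (rule infsum_desc_le_mass[OF k(1) frac_in_unit P0]) (simp add: Psi1_def)
  qed
  finally show ?thesis .
qed

text \<open>The translate has modulus at least \<open>1 / 2\<close> at \<open>i\<close>, so the
  moduli of \<open>g\<close> on the descendants add up to at least \<open>1 / 2\<close>. The
  indicator vanishes on these descendants, hence \<open>g\<close> is there its own
  deviation.\<close>

lemma Phi1_le_mass:
  fixes g :: "'i \<Rightarrow> real \<Rightarrow> 'k::{real_normed_field, euclidean_space}"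
  assumes i: "i \<in> K" "i \<in> arcs G" and disj: "desc G (jump t s) i \<inter> K = {}"
    and close: "norm (translate_family G t g i s - 1) \<le> 1 / 2"
  shows "ennreal (Phi1 G \<rho> i t s) \<le> 2 * mass (\<lambda>i s. g i s - indicator_family K i s) (frac (t + s))"
proof -
  let ?D = "desc G (jump t s) i" and ?u = "frac (t + s)"
  let ?P = "Phi1 G \<rho> i t s"
  let ?h = "\<lambda>i s. g i s - indicator_family K i s"
  have P0: "0 \<le> ?P" using Phi1_nonneg i by blast
  have "norm (1::'k) \<le> norm (translate_family G t g i s) + norm (1 - translate_family G t g i s)"
    by (rule norm_triangle_sub)
  then have "1 \<le> 2 * norm (translate_family G t g i s)"
    using close by (simp add: norm_minus_commute)
  then have "1 \<le> 2 * ennreal (norm (translate_family G t g i s))"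
    using ennreal_leI by (fastforce simp: ennreal_mult)
  also have "\<dots> \<le> 2 * (\<Sum>\<^sub>\<infinity>j\<in>?D. ennreal (norm (g j ?u)))"
    unfolding translate_family_def by (intro mult_left_mono norm_infsum_le_ennreal) simp
  also have "(\<Sum>\<^sub>\<infinity>j\<in>?D. ennreal (norm (g j ?u))) = (\<Sum>\<^sub>\<infinity>j\<in>?D. ennreal (norm (?h j ?u)))"
    using disj by (intro infsum_cong) (auto simp: indicator_family_def)
  finally have "ennreal ?P * 1 \<le> ennreal ?P * (2 * (\<Sum>\<^sub>\<infinity>j\<in>?D. ennreal (norm (?h j ?u))))"
    by (rule mult_left_mono) simp
  also have "\<dots> = 2 * (ennreal ?P * (\<Sum>\<^sub>\<infinity>j\<in>?D. ennreal (norm (?h j ?u))))"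
    by (simp add: ac_simps)
  also have "\<dots> \<le> 2 * mass ?h ?u"
    by (intro mult_left_mono infsum_desc_le_mass i frac_in_unit P0) (simp_all add: Phi1_def)
  finally show ?thesis by simp
qed

end

section \<open>Coordinate sets of almost full measure\<close>

lemma finite_measure_unit_lebesgue: "finite_measure unit_lebesgue"
  by (rule finite_measureI) (simp add: emeasure_unit_lebesgue_space)

text \<open>The sets where all \<open>\<phi> i\<close> stay below \<open>Suc n\<close> increase to
  the whole interval, so continuity from below makes one of them large enough.\<close>

lemma bounded_on_large_set:
  fixes \<phi> :: "'a \<Rightarrow> real \<Rightarrow> real"
  assumes "finite K" "\<And>i. i \<in> K \<Longrightarrow> \<phi> i \<in> borel_measurable unit_lebesgue" "0 < \<eta>"
  obtains C where "C > 0" "{s \<in> {0..<1}. \<forall>i\<in>K. \<phi> i s \<le> C} \<in> sets unit_lebesgue"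
    "measure unit_lebesgue {s \<in> {0..<1}. \<forall>i\<in>K. \<phi> i s \<le> C} > 1 - \<eta>"
proof -
  interpret prob: finite_measure unit_lebesgue by (rule finite_measure_unit_lebesgue)
  define A where "A n = {s \<in> {0..<1}. \<forall>i\<in>K. \<phi> i s \<le> real (Suc n)}" for n
  have A: "A n \<in> sets unit_lebesgue" for n
  proof -
    have "{s \<in> space unit_lebesgue. \<forall>i\<in>K. \<phi> i s \<le> real (Suc n)} \<in> sets unit_lebesgue"
      using assms by (intro sets.sets_Collect_finite_All borel_measurable_le) auto
    then show ?thesis by (simp add: A_def)
  qed
  have "incseq A" by (rule incseq_SucI) (auto simp: A_def)
  then have "(\<lambda>n. measure unit_lebesgue (A n)) \<longlonglongrightarrow> measure unit_lebesgue (\<Union>n. A n)"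
    using A by (intro prob.finite_Lim_measure_incseq) auto
  moreover have "(\<Union>n. A n) = {0..<1}"
  proof (intro equalityI subsetI)
    fix s :: real assume s: "s \<in> {0..<1}"
    \<comment> \<open>The inserted \<open>0\<close> keeps \<open>Max\<close> defined when
      \<open>K\<close> is empty.\<close>
    obtain n where n: "Max (insert 0 ((\<lambda>i. \<phi> i s) ` K)) \<le> real n" using real_arch_simple by blast
    have "\<phi> i s \<le> real (Suc n)" if "i \<in> K" for i using n assms(1) that by (simp add: Max_le_iff)
        (metis add_increasing2 order_trans zero_le_one add.commute)
    then show "s \<in> (\<Union>n. A n)" using s by (auto simp: A_def)
  qed (auto simp: A_def)
  moreover have "measure unit_lebesgue {0..<1} = 1"
    by (simp add: measure_def emeasure_unit_lebesgue_space)
  ultimately have "(\<lambda>n. measure unit_lebesgue (A n)) \<longlonglongrightarrow> 1" by simp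
  then have "\<forall>\<^sub>F n in sequentially. measure unit_lebesgue (A n) > 1 - \<eta>"
    using assms(3) by (intro order_tendstoD(1)) auto
  then obtain n where "measure unit_lebesgue (A n) > 1 - \<eta>"
    by (auto simp: eventually_sequentially)
  then show thesis using A[of n] by (intro that[of "real (Suc n)"]) (auto simp: A_def)
qed

context weighted_tree
begin

text \<open>An upper bound for the reciprocals of the positive weights is a lower bound for the
  weights.\<close>

lemma weight_bounded_below_on_large_set:
  assumes "finite K" "K \<subseteq> arcs G" "0 < \<eta>"
  obtains c where "c > 0" "{s \<in> {0..<1}. \<forall>i\<in>K. c \<le> \<rho> i s} \<in> sets unit_lebesgue"
    "measure unit_lebesgue {s \<in> {0..<1}. \<forall>i\<in>K. c \<le> \<rho> i s} > 1 - \<eta>"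
proof -
  have "(\<lambda>s. inverse (\<rho> i s)) \<in> borel_measurable unit_lebesgue" if "i \<in> K" for i
    using weight_measurable[of i] that assms(2) by (intro borel_measurable_inverse) auto
  then obtain C where C: "C > 0" "{s \<in> {0..<1}. \<forall>i\<in>K. inverse (\<rho> i s) \<le> C} \<in> sets unit_lebesgue"
    "measure unit_lebesgue {s \<in> {0..<1}. \<forall>i\<in>K. inverse (\<rho> i s) \<le> C} > 1 - \<eta>"
    using bounded_on_large_set[OF assms(1), of "\<lambda>i s. inverse (\<rho> i s)" \<eta>] assms(3) by blast
  have "inverse (\<rho> i s) \<le> C \<longleftrightarrow> inverse C \<le> \<rho> i s" if "s \<in> {0..<1}" "i \<in> K" for i s
    using weight_pos[of i s] that assms(2) C(1) by (auto simp: field_simps)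
  then have "{s \<in> {0..<1}. \<forall>i\<in>K. inverse (\<rho> i s) \<le> C} = {s \<in> {0..<1}. \<forall>i\<in>K. inverse C \<le> \<rho> i s}"
    by auto
  then show thesis using C by (intro that[of "inverse C"]) auto
qed

lemma indicator_family_in_L1:
  assumes "finite K" "K \<subseteq> arcs G"
  shows "(indicator_family K :: 'i \<Rightarrow> real \<Rightarrow> 'k::{real_normed_field, euclidean_space}) \<in> L1_families G \<rho>"
proof -
  have "L1_norm G \<rho> (indicator_family K :: 'i \<Rightarrow> real \<Rightarrow> 'k)
      = (\<Sum>\<^sub>\<infinity>i\<in>K. \<integral>\<^sup>+s. ennreal (\<rho> i s) \<partial>unit_lebesgue)"
    unfolding L1_norm_def using assms(2)
    by (intro infsum_cong_neutral) (auto simp: indicator_family_def)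
  also have "\<dots> = (\<Sum>i\<in>K. \<integral>\<^sup>+s. ennreal (\<rho> i s) \<partial>unit_lebesgue)"
    using assms(1) by simp
  finally have "L1_norm G \<rho> (indicator_family K :: 'i \<Rightarrow> real \<Rightarrow> 'k) = (\<Sum>i\<in>K. \<integral>\<^sup>+s. ennreal (\<rho> i s) \<partial>unit_lebesgue)" .
  also have "\<dots> < \<infinity>"
  proof -
    have "(\<integral>\<^sup>+s. ennreal (\<rho> i s) \<partial>unit_lebesgue) < \<infinity>" if "i \<in> K" for i
    proof -
      have i: "i \<in> arcs G" using that assms(2) by blast
      have "(\<integral>\<^sup>+s. ennreal (\<rho> i s) \<partial>unit_lebesgue) = ennreal (integral\<^sup>L unit_lebesgue (\<rho> i))"
        using weight_integrable[OF i] weight_pos[OF i]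
        by (intro nn_integral_eq_integral AE_I2) (auto simp: less_imp_le)
      then show ?thesis by simp
    qed
    then show ?thesis using assms(1) by (simp add: ennreal_sum_less_top)
  qed
  finally have "L1_norm G \<rho> (indicator_family K :: 'i \<Rightarrow> real \<Rightarrow> 'k) < \<infinity>" .
  moreover have "indicator_family K i = (\<lambda>s. (if i \<in> K then 1 else 0) :: 'k)" for i
    by (simp add: indicator_family_def fun_eq_iff)
  ultimately show ?thesis by (simp add: L1_families_def)
qed

text \<open>The infimum in \<open>N1\<close> is taken in the reals, so nonnegativity of the
  integrals is first used to bound it below; then a single good set \<open>E\<close>
  suffices.\<close>

lemma N1_memI:
  assumes "K \<subseteq> arcs G" "0 \<le> t" "E \<in> sets unit_lebesgue" "measure unit_lebesgue E > \<alpha>"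
    and "(LINT s:E|unit_lebesgue. (\<Sum>i\<in>K. Phi1 G \<rho> i t s + Psi1 G \<rho> i t s)) < \<epsilon>"
  shows "t \<in> N1 G \<rho> K \<epsilon> \<alpha>"
proof -
  let ?J = "\<lambda>E. LINT s:E|unit_lebesgue. (\<Sum>i\<in>K. Phi1 G \<rho> i t s + Psi1 G \<rho> i t s)"
  have nonneg: "0 \<le> (\<Sum>i\<in>K. Phi1 G \<rho> i t s + Psi1 G \<rho> i t s)" if "s \<in> {0..<1}" for s
    using assms(1) that by (intro sum_nonneg add_nonneg_nonneg Phi1_nonneg Psi1_nonneg) auto
  have "0 \<le> ?J E" for E
    unfolding set_lebesgue_integral_def
    by (intro integral_nonneg_AE AE_I2) (use nonneg in \<open>auto simp: indicator_def\<close>)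
  then have "bdd_below (?J ` {E \<in> sets unit_lebesgue. measure unit_lebesgue E > \<alpha>})"
    by (intro bdd_belowI[of _ 0]) auto
  then have "(INF E\<in>{E \<in> sets unit_lebesgue. measure unit_lebesgue E > \<alpha>}. ?J E) \<le> ?J E"
    using assms(3,4) by (intro cINF_lower) auto
  then show ?thesis using assms(2,5) by (simp add: N1_def)
qed

text \<open>The quantitative core of the necessity: a family that is close to the indicator of
  \<open>K\<close> both at the start and at time \<open>t\<close> certifies \<open>t\<close>. The
  set \<open>E\<close> keeps the coordinates where the weights on \<open>K\<close> are not small and
  the translate is close to the indicator.\<close>

lemma N1_of_return:
  fixes g :: "'i \<Rightarrow> real \<Rightarrow> 'k::{real_normed_field, euclidean_space}"
  assumes K: "finite K" "K \<subseteq> arcs G"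
    and c: "0 < c" "{s \<in> {0..<1}. \<forall>i\<in>K. c \<le> \<rho> i s} \<in> sets unit_lebesgue"
      "measure unit_lebesgue {s \<in> {0..<1}. \<forall>i\<in>K. c \<le> \<rho> i s} > 1 - (1 - \<alpha>) / 2"
    and \<alpha>: "\<alpha> < 1" and t: "0 \<le> t"
    and disj: "\<And>i s. i \<in> K \<Longrightarrow> s \<in> {0..<1} \<Longrightarrow> desc G (jump t s) i \<inter> K = {}"
    and \<delta>: "0 < \<delta>" "\<delta> \<le> c * (1 - \<alpha>) / 4" "4 * real (card K) * \<delta> < \<epsilon>"
    and g: "g \<in> L1_families G \<rho>" "L1_norm G \<rho> (\<lambda>i s. g i s - indicator_family K i s) \<le> ennreal \<delta>"
    and Tg: "translate_family G t g \<in> L1_families G \<rho>"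
      "L1_norm G \<rho> (\<lambda>i s. translate_family G t g i s - indicator_family K i s) \<le> ennreal \<delta>"
  shows "t \<in> N1 G \<rho> K \<epsilon> \<alpha>"
proof -
  interpret prob: finite_measure unit_lebesgue by (rule finite_measure_unit_lebesgue)
  let ?f = "indicator_family K :: 'i \<Rightarrow> real \<Rightarrow> 'k"
  let ?dg = "mass (\<lambda>i s. g i s - ?f i s)"
  let ?dT = "mass (\<lambda>i s. translate_family G t g i s - ?f i s)"
  let ?C = "{s \<in> {0..<1}. \<forall>i\<in>K. c \<le> \<rho> i s}"
  have f: "?f \<in> L1_families G \<rho>" by (rule indicator_family_in_L1[OF K])
  have mf: "measurable_family (\<lambda>i s. g i s - ?f i s)"
    "measurable_family (\<lambda>i s. translate_family G t g i s - ?f i s)"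
    using f g Tg by (auto intro!: measurable_family_diff simp: L1_families_iff)
  note [measurable] = mass_measurable[OF mf(1)] mass_measurable[OF mf(2)]
  have int: "(\<integral>\<^sup>+s. ?dg s \<partial>unit_lebesgue) \<le> ennreal \<delta>" "(\<integral>\<^sup>+s. ?dT s \<partial>unit_lebesgue) \<le> ennreal \<delta>"
    using g(2) Tg(2) mf by (simp_all add: L1_norm_eq_integral_mass)
  \<comment> \<open>By the Markov inequality at level \<open>c / 2\<close> this bad set has measure
    at most \<open>2 * \<delta> / c\<close>, hence at most
    \<open>(1 - \<alpha>) / 2\<close>.\<close>
  define B where "B = {s \<in> space unit_lebesgue. ennreal (c / 2) \<le> ?dT s}"
  have B: "B \<in> sets unit_lebesgue" unfolding B_def by measurable
  define E where "E = ?C - B"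
  have E: "E \<in> sets unit_lebesgue" using B c by (auto simp: E_def)
  have "measure unit_lebesgue B \<le> (1 - \<alpha>) / 2"
  proof -
    have "ennreal (c / 2) * emeasure unit_lebesgue B = (\<integral>\<^sup>+s. ennreal (c / 2) * indicator B s \<partial>unit_lebesgue)"
      using B by (simp add: nn_integral_cmult_indicator)
    also have "\<dots> \<le> (\<integral>\<^sup>+s. ?dT s \<partial>unit_lebesgue)"
      by (intro nn_integral_mono) (auto simp: B_def indicator_def)
    also have "\<dots> \<le> ennreal \<delta>" by (rule int)
    finally have "ennreal (c / 2 * measure unit_lebesgue B) \<le> ennreal \<delta>"
      using c(1) by (subst ennreal_mult) (simp_all add: prob.emeasure_eq_measure)
    then have "c / 2 * measure unit_lebesgue B \<le> \<delta>" using \<delta>(1) by (simp add: ennreal_le_iff)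
    also have "\<dots> \<le> c / 2 * ((1 - \<alpha>) / 2)" using \<delta>(2) by simp
    finally show ?thesis using c(1) by (simp only: mult_le_cancel_left_pos[of "c / 2"] half_gt_zero)
  qed
  moreover have "measure unit_lebesgue ?C \<le> measure unit_lebesgue (E \<union> B)"
    by (rule prob.finite_measure_mono[OF _ sets.Un[OF E B]]) (auto simp: E_def)
  moreover have "measure unit_lebesgue (E \<union> B) \<le> measure unit_lebesgue E + measure unit_lebesgue B"
    using E B by (intro measure_Un_le)
  \<comment> \<open>The complement of \<open>?C\<close> has measure below
    \<open>(1 - \<alpha>) / 2\<close> and \<open>B\<close> at most that much, so more than
    \<open>\<alpha>\<close> remains.\<close>
  ultimately have mE: "measure unit_lebesgue E > \<alpha>" using c(3) by (simp add: field_simps)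
  \<comment> \<open>For each edge, \<Phi> costs two copies of \<open>?dg\<close>, and \<Psi> costs
    one copy of each mass. Hence the 3 and 1 here and the factor 4 in the final bound.\<close>
  have pw: "ennreal (\<Sum>i\<in>K. Phi1 G \<rho> i t s + Psi1 G \<rho> i t s)
      \<le> of_nat (card K) * (3 * ?dg (frac (t + s)) + ?dT s)" if s: "s \<in> E" for s
  proof -
    have s01: "s \<in> {0..<1}" using s by (simp add: E_def)
    have *: "ennreal (Phi1 G \<rho> i t s + Psi1 G \<rho> i t s) \<le> 3 * ?dg (frac (t + s)) + ?dT s" if i: "i \<in> K" for i
    proof -
      have ia: "i \<in> arcs G" using i K by blast
      have "norm (translate_family G t g i s - 1) \<le> 1 / 2"
      proof (rule ccontr)
        assume "\<not> ?thesis"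
        \<comment> \<open>As the weight is at least \<open>c\<close> on \<open>?C\<close>, a
          deviation above \<open>1 / 2\<close> at \<open>i\<close> alone contributes
          \<open>c / 2\<close> to \<open>?dT\<close>, which would put \<open>s\<close> into
          \<open>B\<close>.\<close>
        then have "1 / 2 * c \<le> norm (translate_family G t g i s - ?f i s) * \<rho> i s"
          using i s c(1) by (intro mult_mono) (auto simp: E_def indicator_family_def)
        then have "ennreal (c / 2) \<le> ennreal (norm (translate_family G t g i s - ?f i s) * \<rho> i s)"
          by (intro ennreal_leI) simp
        also have "\<dots> \<le> ?dT s"
          using term_le_mass[OF ia, of "\<lambda>i s. translate_family G t g i s - ?f i s" s] by simp
        finally show False using s by (auto simp: E_def B_def)
      qed
      then have "ennreal (Phi1 G \<rho> i t s) \<le> 2 * ?dg (frac (t + s))"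
        by (intro Phi1_le_mass i ia disj s01)
      moreover have "ennreal (Psi1 G \<rho> i t s) \<le> ?dT s + ?dg (frac (t + s))"
        by (intro Psi1_le_mass K i s01 disj)
      ultimately have "ennreal (Phi1 G \<rho> i t s) + ennreal (Psi1 G \<rho> i t s)
          \<le> 2 * ?dg (frac (t + s)) + (?dT s + ?dg (frac (t + s)))" by (rule add_mono)
      also have "\<dots> = (2 + 1) * ?dg (frac (t + s)) + ?dT s" by (simp only: distrib_right mult_1 ac_simps)
      finally show ?thesis using Phi1_nonneg[OF ia, of t s] Psi1_nonneg[OF ia s01, of t] by (simp add: ennreal_plus)
    qed
    have "ennreal (\<Sum>i\<in>K. Phi1 G \<rho> i t s + Psi1 G \<rho> i t s)
        = (\<Sum>i\<in>K. ennreal (Phi1 G \<rho> i t s + Psi1 G \<rho> i t s))"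
      using K s01 by (intro sum_ennreal[symmetric] add_nonneg_nonneg Phi1_nonneg Psi1_nonneg) auto
    also have "\<dots> \<le> of_nat (card K) * (3 * ?dg (frac (t + s)) + ?dT s)"
      using * by (intro sum_bounded_above)
    finally show ?thesis .
  qed
  have "(LINT s:E|unit_lebesgue. (\<Sum>i\<in>K. Phi1 G \<rho> i t s + Psi1 G \<rho> i t s)) \<le> 4 * real (card K) * \<delta>"
    unfolding set_lebesgue_integral_def
  proof (rule integral_le_if_nn_integral_le)
    have "(\<integral>\<^sup>+s. ennreal (indicator E s *\<^sub>R (\<Sum>i\<in>K. Phi1 G \<rho> i t s + Psi1 G \<rho> i t s)) \<partial>unit_lebesgue)
        \<le> (\<integral>\<^sup>+s. of_nat (card K) * (3 * ?dg (frac (t + s)) + ?dT s) \<partial>unit_lebesgue)"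
      by (intro nn_integral_mono) (use pw in \<open>auto simp: indicator_def\<close>)
    also have "\<dots> = of_nat (card K) * (3 * (\<integral>\<^sup>+s. ?dg s \<partial>unit_lebesgue) + (\<integral>\<^sup>+s. ?dT s \<partial>unit_lebesgue))"
    proof -
      have [measurable]: "(\<lambda>s. ?dg (frac (t + s))) \<in> borel_measurable unit_lebesgue"
        by (rule measurable_compose[OF frac_translation_measurable]) measurable
      show ?thesis
        by (simp add: nn_integral_cmult nn_integral_add nn_integral_frac_translation)
    qed
    also have "\<dots> \<le> of_nat (card K) * (3 * ennreal \<delta> + ennreal \<delta>)"
      using int by (intro mult_left_mono add_mono) auto
    also have "\<dots> = ennreal (real (card K) * (3 * \<delta> + \<delta>))"
    proof -
      have "ennreal (3 * \<delta> + \<delta>) = 3 * ennreal \<delta> + ennreal \<delta>"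
        using \<delta>(1) by (subst ennreal_plus) (auto simp: ennreal_mult)
      then show ?thesis
        using \<delta>(1) by (subst ennreal_mult) (auto simp: ennreal_of_nat_eq_real_of_nat)
    qed
    also have "real (card K) * (3 * \<delta> + \<delta>) = 4 * real (card K) * \<delta>" by simp
    finally show "(\<integral>\<^sup>+s. ennreal (indicator E s *\<^sub>R (\<Sum>i\<in>K. Phi1 G \<rho> i t s + Psi1 G \<rho> i t s)) \<partial>unit_lebesgue)
        \<le> ennreal (4 * real (card K) * \<delta>)" .
    show "0 \<le> indicator E s *\<^sub>R (\<Sum>i\<in>K. Phi1 G \<rho> i t s + Psi1 G \<rho> i t s)" if "s \<in> space unit_lebesgue" for s
      using that K by (intro scaleR_nonneg_nonneg sum_nonneg add_nonneg_nonneg Phi1_nonneg Psi1_nonneg) auto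
  qed (use \<delta>(1) in simp)
  then show ?thesis using K t E mE \<delta>(3) by (intro N1_memI[of _ _ E]) auto
qed

lemma jump_ge: "t \<ge> real N \<Longrightarrow> s \<in> {0..<1} \<Longrightarrow> jump t s \<ge> N"
  by (simp add: jump_def le_nat_iff le_floor_iff)

lemma recurrent_imp_N1:
  assumes rec: "family_recurrent \<F> (L1_topology G \<rho> :: ('i \<Rightarrow> real \<Rightarrow> 'k::{real_normed_field, euclidean_space}) set topology)
      (left_translation G \<rho>)"
    and \<F>: "furstenberg_family \<F>" "finite_invariant \<F>"
    and K: "finite K" "K \<subseteq> arcs G" and pos: "0 < \<epsilon>" "\<alpha> < 1"
  shows "N1 G \<rho> K \<epsilon> \<alpha> \<in> \<F>"
proof -
  interpret M: Metric_space "L1_space G \<rho> :: ('i \<Rightarrow> real \<Rightarrow> 'k) set set" "L1_dist G \<rho>"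
    by (rule Metric_space_L1)
  let ?f = "indicator_family K :: 'i \<Rightarrow> real \<Rightarrow> 'k"
  have f: "?f \<in> L1_families G \<rho>" by (rule indicator_family_in_L1[OF K])
  obtain c where c: "0 < c" "{s \<in> {0..<1}. \<forall>i\<in>K. c \<le> \<rho> i s} \<in> sets unit_lebesgue"
      "measure unit_lebesgue {s \<in> {0..<1}. \<forall>i\<in>K. c \<le> \<rho> i s} > 1 - (1 - \<alpha>) / 2"
    using weight_bounded_below_on_large_set[OF K, of "(1 - \<alpha>) / 2"] pos by auto
  \<comment> \<open>The first bound keeps the bad set of \<open>N1_of_return\<close> small. The
    second brings the final estimate below \<open>\<epsilon>\<close>; the \<open>+ 1\<close> gives
    strictness and a nonzero denominator.\<close>
  define \<delta> where "\<delta> = min (c * (1 - \<alpha>) / 4) (\<epsilon> / (4 * (real (card K) + 1)))"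
  have \<delta>: "0 < \<delta>" using c(1) pos by (simp add: \<delta>_def)
  have \<delta>2: "\<delta> \<le> c * (1 - \<alpha>) / 4" unfolding \<delta>_def by (rule min.cobounded1)
  have "4 * real (card K) * \<delta> < 4 * (real (card K) + 1) * \<delta>" using \<delta> by simp
  also have "\<dots> \<le> 4 * (real (card K) + 1) * (\<epsilon> / (4 * (real (card K) + 1)))"
    by (intro mult_left_mono) (auto simp: \<delta>_def)
  also have "\<dots> = \<epsilon>" by (simp add: field_simps)
  finally have \<delta>3: "4 * real (card K) * \<delta> < \<epsilon>" .
  obtain N where N: "\<And>n i. n \<ge> N \<Longrightarrow> i \<in> K \<Longrightarrow> desc G n i \<inter> K = {}"
    using eventually_desc_disjoint[OF K] by blast
  define U where "U = M.mball (L1_eq G \<rho> `` {?f}) \<delta>"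
  have "openin (L1_topology G \<rho>) U" by (simp add: U_def L1_topology_def)
  moreover have "U \<noteq> {}" using class_in_L1_space[OF f] \<delta> by (auto simp: U_def)
  ultimately have "hitting_times (left_translation G \<rho>) U U \<in> \<F>"
    using rec by (simp add: family_recurrent_def)
  \<comment> \<open>\<open>finite_invariant\<close> speaks of positive bounds only, whence the
    \<open>+ 1\<close>. For the remaining times \<open>jump t s\<close> is at least
    \<open>N\<close>.\<close>
  then have "hitting_times (left_translation G \<rho>) U U \<inter> {real N + 1<..} \<in> \<F>"
    using \<F>(2) by (simp add: finite_invariant_def)
  moreover have "hitting_times (left_translation G \<rho>) U U \<inter> {real N + 1<..} \<subseteq> N1 G \<rho> K \<epsilon> \<alpha>"
  proof
    fix t assume t: "t \<in> hitting_times (left_translation G \<rho>) U U \<inter> {real N + 1<..}"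
    then obtain F where F: "F \<in> U" "left_translation G \<rho> t F \<in> U" by (auto simp: hitting_times_def)
    let ?g = "rep F"
    let ?Tg = "translate_family G t ?g"
    have near: "L1_norm G \<rho> (\<lambda>i s. h i s - ?f i s) \<le> ennreal \<delta>"
      if h: "h \<in> L1_families G \<rho>" "L1_eq G \<rho> `` {h} \<in> U" for h
    proof -
      have "enn2real (L1_norm G \<rho> (\<lambda>i s. ?f i s - h i s)) < \<delta>"
        using h(2) L1_dist_class[OF f h(1)] by (simp add: U_def)
      moreover have "L1_norm G \<rho> (\<lambda>i s. ?f i s - h i s) < \<infinity>"
        using L1_families_diff[OF f h(1)] L1_families_iff by blast
      ultimately have "L1_norm G \<rho> (\<lambda>i s. ?f i s - h i s) \<le> ennreal \<delta>"
        by (cases "L1_norm G \<rho> (\<lambda>i s. ?f i s - h i s)") (auto simp: ennreal_leI)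
      then show ?thesis by (subst L1_norm_minus_commute)
    qed
    have FL: "F \<in> L1_space G \<rho>" "left_translation G \<rho> t F \<in> L1_space G \<rho>" using F by (auto simp: U_def)
    have g: "?g \<in> L1_families G \<rho>" "L1_eq G \<rho> `` {?g} \<in> U"
      using rep_in_L1_families[OF FL(1)] class_rep[OF FL(1)] F(1) by auto
    \<comment> \<open>For a translate outside \<open>L1_families\<close> the image under
      \<open>L1_eq\<close> would be empty, whereas elements of the quotient are not. This yields
      integrability of \<open>?Tg\<close>.\<close>
    have "left_translation G \<rho> t F \<noteq> {}"
      using FL(2) in_quotient_imp_non_empty[OF equiv_L1_eq] unfolding L1_space_def by blast
    then have Tg: "?Tg \<in> L1_families G \<rho>" by (auto simp: left_translation_def L1_eq_def)
    have "desc G (jump t s) i \<inter> K = {}" if "i \<in> K" "s \<in> {0..<1}" for i s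
      using t that by (intro N jump_ge) auto
    then show "t \<in> N1 G \<rho> K \<epsilon> \<alpha>"
      using t F(2) pos \<delta> \<delta>2 \<delta>3 c near[OF g] near[OF Tg] g(1) Tg
      by (intro N1_of_return[OF K c, of t \<delta> \<epsilon> ?g]) (auto simp: left_translation_def)
  qed
  moreover have "N1 G \<rho> K \<epsilon> \<alpha> \<subseteq> {0..}" by (auto simp: N1_def)
  ultimately show ?thesis using \<F>(1) unfolding furstenberg_family_def by blast
qed

end

section \<open>The weight condition implies transitivity\<close>

text \<open>Absolute continuity of the integral: truncate \<open>\<phi>\<close> at a height
  \<open>n\<close> such that the excess has integral below \<open>e / 2\<close>. The truncated part
  contributes at most \<open>n\<close> times the measure of the set, which the choice of
  \<open>\<eta>\<close> keeps below \<open>e / 2\<close> as well.\<close>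

lemma nn_integral_small_on_small_sets:
  fixes \<phi> :: "'a \<Rightarrow> ennreal"
  assumes \<phi>: "\<phi> \<in> borel_measurable M" "(\<integral>\<^sup>+s. \<phi> s \<partial>M) < \<infinity>" and e: "0 < e"
  obtains \<eta> where "\<eta> > 0"
    "\<And>A. A \<in> sets M \<Longrightarrow> emeasure M A < ennreal \<eta> \<Longrightarrow> (\<integral>\<^sup>+s. \<phi> s * indicator A s \<partial>M) < ennreal e"
proof -
  let ?g = "\<lambda>n s. min (\<phi> s) (of_nat n)"
  have gm[measurable]: "?g n \<in> borel_measurable M" for n using \<phi>(1) by measurable
  have "(SUP n. ?g n s) = \<phi> s" for s
  proof (rule antisym)
    show "\<phi> s \<le> (SUP n. ?g n s)"
    proof (cases "\<phi> s = top")
      case True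
      then show ?thesis by (simp add: ennreal_SUP_of_nat_eq_top)
    next
      case False
      then obtain n where "\<phi> s \<le> of_nat n"
        using ennreal_Ex_less_of_nat[of "\<phi> s"] by (auto simp: less_top dest: less_imp_le)
      then show ?thesis by (intro SUP_upper2[of n]) auto
    qed
  qed (auto intro: SUP_least)
  then have "(\<integral>\<^sup>+s. \<phi> s \<partial>M) = (\<integral>\<^sup>+s. (SUP n. ?g n s) \<partial>M)" by simp
  also have "\<dots> = (SUP n. \<integral>\<^sup>+s. ?g n s \<partial>M)"
    by (intro nn_integral_monotone_convergence_SUP incseq_SucI le_funI min.mono gm) auto
  finally have S: "(\<integral>\<^sup>+s. \<phi> s \<partial>M) = (SUP n. \<integral>\<^sup>+s. ?g n s \<partial>M)" .
  have "\<exists>n\<in>UNIV. (\<integral>\<^sup>+s. \<phi> s \<partial>M) < (\<integral>\<^sup>+s. ?g n s \<partial>M) + ennreal (e / 2)"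
    by (rule SUP_approx_ennreal[OF _ _ S]) (use \<phi>(2) e in auto)
  then obtain n where n: "(\<integral>\<^sup>+s. \<phi> s \<partial>M) < (\<integral>\<^sup>+s. ?g n s \<partial>M) + ennreal (e / 2)" by blast
  show thesis
  proof (rule that[of "e / (2 * (real n + 1))"])
    show "0 < e / (2 * (real n + 1))" using e by simp
    fix A assume A[measurable]: "A \<in> sets M" and small: "emeasure M A < ennreal (e / (2 * (real n + 1)))"
    have fin: "(\<integral>\<^sup>+s. ?g n s \<partial>M) < \<infinity>"
      using \<phi>(2) by (rule order.strict_trans1[rotated]) (intro nn_integral_mono, simp)
    have split: "\<phi> s = ?g n s + (\<phi> s - ?g n s)" for s
      by (simp add: add_diff_inverse_ennreal)
    have "(\<integral>\<^sup>+s. \<phi> s \<partial>M) = (\<integral>\<^sup>+s. ?g n s \<partial>M) + (\<integral>\<^sup>+s. \<phi> s - ?g n s \<partial>M)"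
      using \<phi>(1) by (subst nn_integral_add[symmetric]) (auto simp flip: split)
    with n have d: "(\<integral>\<^sup>+s. \<phi> s - ?g n s \<partial>M) < ennreal (e / 2)"
      using fin by (simp add: ennreal_add_left_cancel_less)
    have "(\<integral>\<^sup>+s. \<phi> s * indicator A s \<partial>M) \<le> (\<integral>\<^sup>+s. (\<phi> s - ?g n s) + of_nat n * indicator A s \<partial>M)"
    proof (rule nn_integral_mono)
      fix s
      have "\<phi> s = (\<phi> s - ?g n s) + ?g n s" using split[of s] by (simp add: add.commute)
      also have "\<dots> \<le> (\<phi> s - ?g n s) + of_nat n" by (intro add_left_mono) simp
      finally show "\<phi> s * indicator A s \<le> (\<phi> s - ?g n s) + of_nat n * indicator A s"
        by (auto simp: indicator_def)
    qed
    also have "\<dots> = (\<integral>\<^sup>+s. \<phi> s - ?g n s \<partial>M) + of_nat n * emeasure M A"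
      using \<phi>(1) by (subst nn_integral_add) (auto simp: nn_integral_cmult_indicator)
    also have "\<dots> < ennreal (e / 2) + ennreal (e / 2)"
    proof (rule add_strict_mono[OF d])
      have "of_nat n * emeasure M A \<le> of_nat n * ennreal (e / (2 * (real n + 1)))"
        using small by (intro mult_left_mono) auto
      also have "\<dots> = ennreal (real n * (e / (2 * (real n + 1))))"
        using e by (subst ennreal_mult) (auto simp: ennreal_of_nat_eq_real_of_nat)
      also have "\<dots> < ennreal (e / 2)"
        using e by (intro ennreal_lessI) (auto simp: field_simps)
      finally show "of_nat n * emeasure M A < ennreal (e / 2)" .
    qed
    also have "\<dots> = ennreal e" using e by (simp flip: ennreal_plus)
    finally show "(\<integral>\<^sup>+s. \<phi> s * indicator A s \<partial>M) < ennreal e" .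
  qed
qed

text \<open>A finite partial sum within \<open>e\<close> of the total leaves a remainder below
  \<open>e\<close>; finiteness permits the cancellation in \<open>ennreal\<close>.\<close>

lemma infsum_tail_small:
  fixes a :: "'a \<Rightarrow> ennreal"
  assumes "infsum a A < \<infinity>" "0 < e"
  obtains K0 where "finite K0" "K0 \<subseteq> A" "\<And>K. K0 \<subseteq> K \<Longrightarrow> K \<subseteq> A \<Longrightarrow> infsum a (A - K) < ennreal e"
proof -
  have inf: "infsum a A = (SUP F\<in>{F. finite F \<and> F \<subseteq> A}. sum a F)"
    by (rule nonneg_infsum_complete) simp
  have "\<exists>K0\<in>{F. finite F \<and> F \<subseteq> A}. infsum a A < sum a K0 + ennreal e"
    by (rule SUP_approx_ennreal[OF assms(2) _ inf]) (use assms(1) in auto)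
  then obtain K0 where K0: "finite K0" "K0 \<subseteq> A" "infsum a A < sum a K0 + ennreal e" by blast
  show thesis
  proof (rule that[OF K0(1,2)])
    fix K assume K: "K0 \<subseteq> K" "K \<subseteq> A"
    have "infsum a A = infsum a K0 + infsum a (A - K0)"
      using K0(2) infsum_Un_disjoint[of a K0 "A - K0"] by (simp add: nonneg_summable_on_complete Un_absorb1)
    moreover have "infsum a (A - K) \<le> infsum a (A - K0)"
      using K by (intro infsum_mono_neutral) (auto intro: nonneg_summable_on_complete)
    moreover have "sum a K0 < \<infinity>"
      using finite_sum_le_infsum_ennreal[OF K0(1,2), of a] assms(1) by (rule order.strict_trans1)
    ultimately show "infsum a (A - K) < ennreal e"
      using K0(1,3) by (auto simp: ennreal_add_left_cancel_less intro: order.strict_trans1)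
  qed
qed

context weighted_tree
begin

text \<open>The error comes from the edges outside \<open>K\<close>, controlled by the tail of the
  sum, and from the coordinates in \<open>A\<close>, controlled by absolute continuity.
  \<open>K0\<close> is fixed first and \<open>\<eta>\<close> may depend on \<open>K\<close>, so that
  one \<open>K\<close> can serve two families at once.\<close>

lemma L1_norm_truncation_small:
  fixes f :: "'i \<Rightarrow> real \<Rightarrow> 'k::{real_normed_field, euclidean_space}"
  assumes f: "f \<in> L1_families G \<rho>" and \<delta>: "0 < \<delta>"
  obtains K0 where "finite K0" "K0 \<subseteq> arcs G"
    "\<And>K. finite K \<Longrightarrow> K0 \<subseteq> K \<Longrightarrow> K \<subseteq> arcs G \<Longrightarrow> \<exists>\<eta>>0. \<forall>A\<in>sets unit_lebesgue.
      emeasure unit_lebesgue A < ennreal \<eta> \<longrightarrow>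
      L1_norm G \<rho> (\<lambda>i s. if i \<in> K \<and> s \<notin> A then 0 else f i s) < ennreal \<delta>"
proof -
  let ?a = "\<lambda>i. \<integral>\<^sup>+s. ennreal (norm (f i s) * \<rho> i s) \<partial>unit_lebesgue"
  have mf: "measurable_family f" and fin: "infsum ?a (arcs G) < \<infinity>"
    using f by (simp_all add: L1_families_iff L1_norm_def)
  obtain K0 where K0: "finite K0" "K0 \<subseteq> arcs G"
    "\<And>K. K0 \<subseteq> K \<Longrightarrow> K \<subseteq> arcs G \<Longrightarrow> infsum ?a (arcs G - K) < ennreal (\<delta> / 2)"
    using infsum_tail_small[OF fin, of "\<delta> / 2"] \<delta> by auto
  show thesis
  proof (rule that[OF K0(1,2)])
    fix K assume K: "finite K" "K0 \<subseteq> K" "K \<subseteq> arcs G"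
    let ?\<phi> = "\<lambda>s. \<Sum>i\<in>K. ennreal (norm (f i s) * \<rho> i s)"
    have m: "(\<lambda>s. ennreal (norm (f i s) * \<rho> i s)) \<in> borel_measurable unit_lebesgue" if "i \<in> K" for i
      using integrand_measurable[OF mf] that K(3) by blast
    then have \<phi>m: "?\<phi> \<in> borel_measurable unit_lebesgue" by simp
    have "(\<integral>\<^sup>+s. ?\<phi> s \<partial>unit_lebesgue) = sum ?a K" using m by (rule nn_integral_sum)
    also have "\<dots> \<le> infsum ?a (arcs G)" using K by (intro finite_sum_le_infsum_ennreal)
    also have "\<dots> < \<infinity>" by (rule fin)
    finally obtain \<eta> where \<eta>: "\<eta> > 0" "\<And>A. A \<in> sets unit_lebesgue \<Longrightarrow> emeasure unit_lebesgue A < ennreal \<eta> \<Longrightarrow>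
        (\<integral>\<^sup>+s. ?\<phi> s * indicator A s \<partial>unit_lebesgue) < ennreal (\<delta> / 2)"
      using nn_integral_small_on_small_sets[OF \<phi>m, of "\<delta> / 2"] \<delta> by auto
    have "L1_norm G \<rho> (\<lambda>i s. if i \<in> K \<and> s \<notin> A then 0 else f i s) < ennreal \<delta>"
      if A: "A \<in> sets unit_lebesgue" "emeasure unit_lebesgue A < ennreal \<eta>" for A
    proof -
      let ?b = "\<lambda>i. \<integral>\<^sup>+s. ennreal (norm (if i \<in> K \<and> s \<notin> A then 0 else f i s) * \<rho> i s) \<partial>unit_lebesgue"
      have "L1_norm G \<rho> (\<lambda>i s. if i \<in> K \<and> s \<notin> A then 0 else f i s) = infsum ?b K + infsum ?b (arcs G - K)"
        unfolding L1_norm_def using K(3) infsum_Un_disjoint[of ?b K "arcs G - K"]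
        by (simp add: nonneg_summable_on_complete Un_absorb1)
      also have "infsum ?b (arcs G - K) = infsum ?a (arcs G - K)"
        by (intro infsum_cong) auto
      also have "infsum ?b K = sum ?b K" using K(1) by simp
      also have "\<dots> = (\<Sum>i\<in>K. \<integral>\<^sup>+s. ennreal (norm (f i s) * \<rho> i s) * indicator A s \<partial>unit_lebesgue)"
        by (intro sum.cong nn_integral_cong) (auto simp: indicator_def)
      also have "\<dots> = (\<integral>\<^sup>+s. ?\<phi> s * indicator A s \<partial>unit_lebesgue)"
        using m A(1) by (subst nn_integral_sum[symmetric]) (auto simp: sum_distrib_right)
      also have "\<dots> + infsum ?a (arcs G - K) < ennreal (\<delta> / 2) + ennreal (\<delta> / 2)"
        using \<eta>(2)[OF A] K0(3)[OF K(2,3)] by (rule add_strict_mono)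
      also have "\<dots> = ennreal \<delta>" using \<delta> by (simp flip: ennreal_plus)
      finally show ?thesis .
    qed
    then show "\<exists>\<eta>>0. \<forall>A\<in>sets unit_lebesgue. emeasure unit_lebesgue A < ennreal \<eta> \<longrightarrow>
        L1_norm G \<rho> (\<lambda>i s. if i \<in> K \<and> s \<notin> A then 0 else f i s) < ennreal \<delta>"
      using \<eta>(1) by blast
  qed
qed

text \<open>\<open>jump t\<close> has countably many values, so only a fixed generation
  \<open>n\<close> has to be considered.\<close>

lemma jump_dependent_measurable:
  assumes "\<And>n. (\<lambda>s. \<phi> n s) \<in> unit_lebesgue \<rightarrow>\<^sub>M N"
  shows "(\<lambda>s. \<phi> (jump t s) s) \<in> unit_lebesgue \<rightarrow>\<^sub>M N"
  using assms jump_measurable by (rule measurable_compose_countable)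

lemma frac_translated_measurable:
  "\<phi> \<in> unit_lebesgue \<rightarrow>\<^sub>M N \<Longrightarrow> (\<lambda>s. \<phi> (frac (t + s))) \<in> unit_lebesgue \<rightarrow>\<^sub>M N"
  using measurable_compose[OF frac_translation_measurable] .

section \<open>Measurability and integrability of \<Phi> and \<Psi>\<close>

lemma INF_weights_measurable:
  assumes "k \<in> arcs G"
  shows "(\<lambda>u. INF j\<in>desc G n k. \<rho> j u) \<in> borel_measurable unit_lebesgue"
proof (rule borel_measurable_cINF)
  have D: "desc G n k \<subseteq> arcs G" using desc_in_arcs assms by blast
  then show "countable (desc G n k)" using countable_arcs countable_subset by blast
  show "\<And>j. j \<in> desc G n k \<Longrightarrow> \<rho> j \<in> borel_measurable unit_lebesgue"
    using D weight_measurable by blast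
  show "\<And>u. u \<in> space unit_lebesgue \<Longrightarrow> bdd_below ((\<lambda>j. \<rho> j u) ` desc G n k)"
    by (rule bdd_below_weights[OF assms]) simp
qed

lemma Phi1_measurable:
  assumes "i \<in> arcs G" shows "Phi1 G \<rho> i t \<in> borel_measurable unit_lebesgue"
proof -
  have "(\<lambda>s. INF j\<in>desc G n i. \<rho> j (frac (t + s))) \<in> borel_measurable unit_lebesgue" for n
    by (rule frac_translated_measurable[OF INF_weights_measurable[OF assms]])
  then show ?thesis unfolding Phi1_def[abs_def] by (rule jump_dependent_measurable)
qed

lemma Psi1_measurable:
  assumes "i \<in> arcs G" shows "Psi1 G \<rho> i t \<in> borel_measurable unit_lebesgue"
proof -
  have "(\<lambda>s. min (\<rho> (anc G n i) s) (INF j\<in>desc G n (anc G n i). \<rho> j (frac (t + s)))) \<in> borel_measurable unit_lebesgue" for n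
    using weight_measurable[OF anc_in_arcs[OF assms]]
      frac_translated_measurable[OF INF_weights_measurable[OF anc_in_arcs[OF assms]]]
    by (intro borel_measurable_min) simp_all
  then show ?thesis unfolding Psi1_def[abs_def] by (rule jump_dependent_measurable)
qed

lemma jump_cases:
  assumes "0 \<le> t" "s \<in> {0..<1}" shows "jump t s = nat \<lfloor>t\<rfloor> \<or> jump t s = Suc (nat \<lfloor>t\<rfloor>)"
proof -
  have "\<lfloor>t + s\<rfloor> = \<lfloor>t\<rfloor> \<or> \<lfloor>t + s\<rfloor> = \<lfloor>t\<rfloor> + 1" using assms(2) by (auto simp: floor_eq_iff) linarith+
  moreover have "0 \<le> \<lfloor>t\<rfloor>" using assms(1) by simp
  ultimately show ?thesis by (auto simp: jump_def nat_add_distrib)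
qed

lemma weight_frac_integrable: "i \<in> arcs G \<Longrightarrow> integrable unit_lebesgue (\<lambda>s. \<rho> i (frac (t + s)))"
  using weight_integrable[of i] integrable_distr[OF frac_translation_measurable, of t "\<rho> i"]
  by (simp add: distr_frac_translation)

text \<open>For fixed \<open>t\<close> only two generations occur. One chosen descendant and the
  ancestor in each of them dominate the infima, which gives four integrable functions as a
  bound.\<close>

lemma Phi1_Psi1_integrable:
  assumes i: "i \<in> arcs G" and t: "0 \<le> t"
  shows "integrable unit_lebesgue (\<lambda>s. Phi1 G \<rho> i t s + Psi1 G \<rho> i t s)"
proof (rule Bochner_Integration.integrable_bound)
  define m where "m = nat \<lfloor>t\<rfloor>"
  define d where "d n = (SOME j. j \<in> desc G n i)" for n
  have d: "d n \<in> desc G n i" for n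
    unfolding d_def using desc_nonempty[OF i, of n] by (simp add: some_in_eq)
  have da: "d n \<in> arcs G" for n using d desc_in_arcs i by blast
  let ?b = "\<lambda>s. (\<rho> (d m) (frac (t + s)) + \<rho> (d (Suc m)) (frac (t + s)))
    + (\<rho> (anc G m i) s + \<rho> (anc G (Suc m) i) s)"
  show "integrable unit_lebesgue ?b"
    by (intro Bochner_Integration.integrable_add weight_frac_integrable weight_integrable da anc_in_arcs i)
  show "(\<lambda>s. Phi1 G \<rho> i t s + Psi1 G \<rho> i t s) \<in> borel_measurable unit_lebesgue"
    by (intro borel_measurable_add Phi1_measurable Psi1_measurable i)
  have "norm (Phi1 G \<rho> i t s + Psi1 G \<rho> i t s) \<le> norm (?b s)" if s: "s \<in> {0..<1}" for s
  proof -
    have "Phi1 G \<rho> i t s \<le> \<rho> (d (jump t s)) (frac (t + s))"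
      unfolding Phi1_def by (rule cINF_lower[OF bdd_below_weights[OF i frac_in_unit] d])
    moreover have "Psi1 G \<rho> i t s \<le> \<rho> (anc G (jump t s) i) s" by (simp add: Psi1_def)
    moreover have "0 \<le> Phi1 G \<rho> i t s" "0 \<le> Psi1 G \<rho> i t s" using Phi1_nonneg Psi1_nonneg i s by auto
    moreover have "0 < \<rho> (d n) (frac (t + s))" "0 < \<rho> (anc G n i) s" for n
      using weight_pos[OF da frac_in_unit] weight_pos[OF anc_in_arcs[OF i] s] by auto
    from this[of m] this[of "Suc m"]
    have "0 < \<rho> (d m) (frac (t + s))" "0 < \<rho> (d (Suc m)) (frac (t + s))" "0 < \<rho> (anc G m i) s" "0 < \<rho> (anc G (Suc m) i) s"
      by auto
    ultimately show ?thesis using jump_cases[OF t s] unfolding m_def[symmetric] by auto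
  qed
  then show "AE s in unit_lebesgue. norm (Phi1 G \<rho> i t s + Psi1 G \<rho> i t s) \<le> norm (?b s)"
    by (intro AE_I2) simp
qed

text \<open>Integrability identifies the Bochner integrals in \<open>N1\<close> with nonnegative
  ones; the default value \<open>0\<close> of a non-integrable function would carry no
  information.\<close>

lemma N1_memD:
  assumes t: "t \<in> N1 G \<rho> K \<epsilon> \<alpha>" and K: "finite K" "K \<subseteq> arcs G" and "\<alpha> < 1"
  obtains E where "E \<in> sets unit_lebesgue" "measure unit_lebesgue E > \<alpha>"
    "(\<integral>\<^sup>+s. ennreal (\<Sum>i\<in>K. Phi1 G \<rho> i t s + Psi1 G \<rho> i t s) * indicator E s \<partial>unit_lebesgue) < ennreal \<epsilon>"
proof -
  let ?z = "\<lambda>s. \<Sum>i\<in>K. Phi1 G \<rho> i t s + Psi1 G \<rho> i t s"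
  let ?S = "{E \<in> sets unit_lebesgue. measure unit_lebesgue E > \<alpha>}"
  let ?J = "\<lambda>E. LINT s:E|unit_lebesgue. ?z s"
  have "measure unit_lebesgue {0..<1} = 1" by (simp add: measure_def emeasure_unit_lebesgue_space)
  moreover have "{0..<1} \<in> sets unit_lebesgue" using sets.top[of unit_lebesgue] by simp
  \<comment> \<open>The whole interval qualifies because \<open>\<alpha> < 1\<close>. So the infimum
    is over a nonempty set, and some member falls below \<open>\<epsilon>\<close>.\<close>
  ultimately have "{0..<1} \<in> ?S" using assms(4) by simp
  then have "?J ` ?S \<noteq> {}" by blast
  moreover have "Inf (?J ` ?S) < \<epsilon>" and t0: "0 \<le> t" using t by (auto simp: N1_def)
  ultimately have "\<exists>x\<in>?J ` ?S. x < \<epsilon>" by (intro cInf_lessD)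
  then obtain E where E: "E \<in> ?S" "?J E < \<epsilon>" unfolding bex_simps by auto
  have z0: "0 \<le> ?z s" if "s \<in> {0..<1}" for s
    using K that by (intro sum_nonneg add_nonneg_nonneg Phi1_nonneg Psi1_nonneg) auto
  have int: "integrable unit_lebesgue ?z"
    using K t0 by (intro Bochner_Integration.integrable_sum Phi1_Psi1_integrable) auto
  then have "integrable unit_lebesgue (\<lambda>s. indicator E s *\<^sub>R ?z s)"
    using E by (intro integrable_mult_indicator) auto
  then have "(\<integral>\<^sup>+s. ennreal (indicator E s *\<^sub>R ?z s) \<partial>unit_lebesgue) = ennreal (?J E)"
    unfolding set_lebesgue_integral_def
    by (rule nn_integral_eq_integral) (use z0 in \<open>auto intro!: AE_I2 simp: indicator_def\<close>)
  moreover have "(\<integral>\<^sup>+s. ennreal (indicator E s *\<^sub>R ?z s) \<partial>unit_lebesgue)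
      = (\<integral>\<^sup>+s. ennreal (?z s) * indicator E s \<partial>unit_lebesgue)"
    by (intro nn_integral_cong) (auto simp: indicator_def)
  ultimately have "(\<integral>\<^sup>+s. ennreal (?z s) * indicator E s \<partial>unit_lebesgue) = ennreal (?J E)"
    by (simp only:)
  moreover have "0 \<le> ?J E"
    unfolding set_lebesgue_integral_def
    by (intro integral_nonneg_AE AE_I2) (use z0 in \<open>auto simp: indicator_def\<close>)
  ultimately have "(\<integral>\<^sup>+s. ennreal (?z s) * indicator E s \<partial>unit_lebesgue) < ennreal \<epsilon>"
    using E(2) by (simp only: ennreal_less_iff)
  then show thesis using E(1) by (intro that[of E]) auto
qed

end

locale admissible_tree = weighted_tree G \<rho> for G :: "('v, 'i) pre_digraph" (structure) and \<rho> +
  assumes admissible: "admissible1 G \<rho>"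
begin

text \<open>Admissibility bounds the infimum below by a positive multiple of
  \<open>\<rho> i s\<close>.\<close>

lemma Phi1_pos:
  assumes "i \<in> arcs G" "0 \<le> t" "s \<in> {0..<1}" shows "0 < Phi1 G \<rho> i t s"
proof -
  obtain M \<omega> where "M \<ge> 1" and
    M: "\<And>i t s. i \<in> arcs G \<Longrightarrow> t \<ge> 0 \<Longrightarrow> s \<in> {0..<1} \<Longrightarrow>
      \<rho> i s \<le> M * exp (\<omega> * t) * (INF j\<in>desc G (jump t s) i. \<rho> j (frac (t + s)))"
    using admissible unfolding admissible1_def by blast
  have "0 < M * exp (\<omega> * t) * Phi1 G \<rho> i t s"
    using M[OF assms] weight_pos[OF assms(1,3)] by (simp add: Phi1_def)
  then show ?thesis by (rule zero_less_mult_pos) (use \<open>M \<ge> 1\<close> in simp)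
qed

text \<open>The first suitable edge in an enumeration is taken, instead of an arbitrary one, so that
  the choice depends measurably on \<open>s\<close>.\<close>

definition light_desc :: "real \<Rightarrow> real \<Rightarrow> 'i \<Rightarrow> 'i" where
  "light_desc t s k = from_nat_into (arcs G) (LEAST m. from_nat_into (arcs G) m \<in> desc G (jump t s) k
     \<and> \<rho> (from_nat_into (arcs G) m) (frac (t + s)) \<le> 2 * Phi1 G \<rho> k t s)"

text \<open>Since the infimum \<Phi> is positive, it lies strictly below its double, hence so does
  the weight of some descendant.\<close>

lemma
  assumes "k \<in> arcs G" "0 \<le> t" "s \<in> {0..<1}"
  shows light_desc_in: "light_desc t s k \<in> desc G (jump t s) k"
    and light_desc_le: "\<rho> (light_desc t s k) (frac (t + s)) \<le> 2 * Phi1 G \<rho> k t s"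
proof -
  let ?P = "\<lambda>m. from_nat_into (arcs G) m \<in> desc G (jump t s) k
     \<and> \<rho> (from_nat_into (arcs G) m) (frac (t + s)) \<le> 2 * Phi1 G \<rho> k t s"
  have "(INF j\<in>desc G (jump t s) k. \<rho> j (frac (t + s))) < 2 * Phi1 G \<rho> k t s"
    using Phi1_pos[OF assms] by (simp add: Phi1_def)
  then obtain j where j: "j \<in> desc G (jump t s) k" "\<rho> j (frac (t + s)) < 2 * Phi1 G \<rho> k t s"
    using desc_nonempty[OF assms(1)] by (subst (asm) cINF_less_iff[OF _ bdd_below_weights[OF assms(1) frac_in_unit]]) auto
  then have "j \<in> arcs G" using desc_in_arcs assms(1) by blast
  then obtain m where "from_nat_into (arcs G) m = j"
    using from_nat_into_surj[OF countable_arcs] by blast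
  then have "?P m" using j by simp
  then have "?P (LEAST m. ?P m)" by (rule LeastI)
  then show "light_desc t s k \<in> desc G (jump t s) k" "\<rho> (light_desc t s k) (frac (t + s)) \<le> 2 * Phi1 G \<rho> k t s"
    unfolding light_desc_def by auto
qed

lemma light_desc_measurable:
  assumes "k \<in> arcs G" shows "(\<lambda>s. light_desc t s k) \<in> unit_lebesgue \<rightarrow>\<^sub>M count_space UNIV"
proof -
  let ?e = "from_nat_into (arcs G)"
  have e: "?e m \<in> arcs G" for m using arcs_nonempty by (rule from_nat_into)
  have "(\<lambda>s. ?e m \<in> desc G (jump t s) k \<and> \<rho> (?e m) (frac (t + s)) \<le> 2 * Phi1 G \<rho> k t s)
      \<in> unit_lebesgue \<rightarrow>\<^sub>M count_space UNIV" for m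
  proof -
    have [measurable]: "(\<lambda>s. ?e m \<in> desc G (jump t s) k) \<in> unit_lebesgue \<rightarrow>\<^sub>M count_space UNIV"
      by (rule measurable_compose[OF jump_measurable]) simp
    have [measurable]: "(\<lambda>s. \<rho> (?e m) (frac (t + s))) \<in> borel_measurable unit_lebesgue"
      "Phi1 G \<rho> k t \<in> borel_measurable unit_lebesgue"
      using frac_translated_measurable[OF weight_measurable[OF e]] Phi1_measurable[OF assms] by auto
    show ?thesis by measurable
  qed
  then have "(\<lambda>s. LEAST m. ?e m \<in> desc G (jump t s) k \<and> \<rho> (?e m) (frac (t + s)) \<le> 2 * Phi1 G \<rho> k t s)
      \<in> unit_lebesgue \<rightarrow>\<^sub>M count_space UNIV"
    by (rule measurable_Least)
  then show ?thesis unfolding light_desc_def by (rule measurable_compose) simp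
qed

end

text \<open>
  At time \<open>t\<close> the family \<open>source + push\<close> is mapped close to \<open>target\<close>: \<open>push\<close> places
  on a light descendant of each edge what is missing to \<open>target\<close>, and it cancels the image of
  \<open>source\<close> except where the weight of the image is already small.
\<close>

locale transfer = admissible_tree G \<rho> for G :: "('v, 'i) pre_digraph" (structure) and \<rho> +
  fixes K :: "'i set" and E :: "real set" and t C :: real
    and f g :: "'i \<Rightarrow> real \<Rightarrow> 'k::{real_normed_field, euclidean_space}"
  assumes K: "finite K" "K \<subseteq> arcs G" and E: "E \<in> sets unit_lebesgue" and t: "0 \<le> t" and C: "0 \<le> C"
    and mf: "measurable_family f" "measurable_family g"
    and f_bound: "\<And>j s. j \<in> K \<Longrightarrow> s \<in> E \<Longrightarrow> norm (f j (frac (t + s))) \<le> C"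
    and g_bound: "\<And>j s. j \<in> K \<Longrightarrow> s \<in> E \<Longrightarrow> norm (g j s) \<le> C"
begin

text \<open>\<open>f\<close> cut down to \<open>K\<close> and to a set of coordinates. As
  \<open>E\<close> refers to the coordinate \<open>s\<close> of the image, the test at
  \<open>u = frac (t + s)\<close> is made after rotating back.\<close>

definition source :: "'i \<Rightarrow> real \<Rightarrow> 'k" where
  "source j u = (if j \<in> K \<and> frac (- t + u) \<in> E then f j u else 0)"

definition target :: "'i \<Rightarrow> real \<Rightarrow> 'k" where
  "target k s = (if k \<in> K \<and> s \<in> E then g k s else 0)"

text \<open>The translate of \<open>source\<close>, written as a finite sum over \<open>K\<close>
  sorted by ancestors.\<close>

definition source_image :: "'i \<Rightarrow> real \<Rightarrow> 'k" where
  "source_image k s = (\<Sum>j\<in>K. if anc G (jump t s) j = k then source j (frac (t + s)) else 0)"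

text \<open>The amount to be added to the image at \<open>k\<close>. The image of
  \<open>source\<close> is cancelled only where a light descendant is the cheaper place, that is,
  where \<Phi> is below the weight of \<open>k\<close>.\<close>

definition correction :: "'i \<Rightarrow> real \<Rightarrow> 'k" where
  "correction k s = target k s - (if Phi1 G \<rho> k t s < \<rho> k s then source_image k s else 0)"

text \<open>In terms of \<open>s\<close>, the whole correction due at an ancestor \<open>k\<close>
  is put on the single edge \<open>light_desc t s k\<close>, at the coordinate
  \<open>frac (t + s)\<close>.\<close>

definition push :: "'i \<Rightarrow> real \<Rightarrow> 'k" where
  "push j u = (let s = frac (- t + u); k = anc G (jump t s) j
     in if light_desc t s k = j then correction k s else 0)"

definition start :: "'i \<Rightarrow> real \<Rightarrow> 'k" where
  "start j u = source j u + push j u"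

section \<open>Pointwise cost of the transfer\<close>

lemma E_unit: "s \<in> E \<Longrightarrow> s \<in> {0..<1}"
  using sets.sets_into_space[OF E] by auto

lemma source_frac: "s \<in> {0..<1} \<Longrightarrow>
    source j (frac (t + s)) = (if j \<in> K \<and> s \<in> E then f j (frac (t + s)) else 0)"
  unfolding source_def by (simp only: frac_translation_inverse(1))

lemma push_frac: "s \<in> {0..<1} \<Longrightarrow>
    push j (frac (t + s)) = (if light_desc t s (anc G (jump t s) j) = j then correction (anc G (jump t s) j) s else 0)"
  unfolding push_def Let_def by (simp only: frac_translation_inverse(1))

text \<open>Among the descendants of \<open>k\<close> only the light one carries a value of
  \<open>push\<close>, and only edges of \<open>K\<close> carry one of \<open>source\<close>. The
  possibly infinite sum therefore collapses to a finite one.\<close>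

lemma translate_start:
  assumes k: "k \<in> arcs G" and s: "s \<in> {0..<1}"
  shows "translate_family G t start k s = source_image k s + correction k s"
proof -
  let ?n = "jump t s" and ?u = "frac (t + s)"
  let ?D = "desc G ?n k" and ?l = "light_desc t s k"
  have l: "?l \<in> ?D" by (rule light_desc_in[OF k t s])
  have D: "?D \<subseteq> arcs G" using desc_in_arcs k by blast
  have an: "anc G ?n j = k" if "j \<in> ?D" for j using anc_eq[OF k that] .
  have p: "push j ?u = (if j = ?l then correction k s else 0)" if "j \<in> ?D" for j
    using an[OF that] by (auto simp: push_frac[OF s])
  let ?F = "insert ?l (?D \<inter> K)"
  have fin: "finite ?F" using K by simp
  have "translate_family G t start k s = infsum (\<lambda>j. start j ?u) ?F"
    unfolding translate_family_def
  proof (rule infsum_cong_neutral)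
    fix j assume "j \<in> ?D - ?F"
    then show "start j ?u = 0" using p[of j] by (auto simp: start_def source_def)
  qed (use l in auto)
  also have "\<dots> = (\<Sum>j\<in>?F. source j ?u) + (\<Sum>j\<in>?F. push j ?u)"
    using fin by (simp add: start_def sum.distrib)
  also have "(\<Sum>j\<in>?F. push j ?u) = (\<Sum>j\<in>?F. if j = ?l then correction k s else 0)"
    using l by (intro sum.cong) (auto simp: p)
  also have "\<dots> = correction k s" using fin by (subst sum.delta) auto
  also have "(\<Sum>j\<in>?F. source j ?u) = (\<Sum>j\<in>?D \<inter> K. source j ?u)"
    using fin by (intro sum.mono_neutral_right) (use l in \<open>auto simp: source_def\<close>)
  also have "\<dots> = (\<Sum>j\<in>?D \<inter> K. if anc G ?n j = k then source j ?u else 0)"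
    by (intro sum.cong) (auto simp: an)
  also have "\<dots> = source_image k s"
    unfolding source_image_def using K in_desc_iff[OF k] by (intro sum.mono_neutral_left) auto
  finally show ?thesis .
qed

text \<open>Where the image of \<open>source\<close> is cancelled the difference is
  \<open>0\<close>; elsewhere it is that image, and the minimum equals
  \<open>\<rho> k s\<close>.\<close>

lemma norm_translate_start_diff:
  assumes "k \<in> arcs G" "s \<in> {0..<1}"
  shows "norm (translate_family G t start k s - target k s) * \<rho> k s \<le> norm (source_image k s) * min (\<rho> k s) (Phi1 G \<rho> k t s)"
  using Phi1_nonneg[OF assms(1), of t s] weight_pos[OF assms]
  by (simp add: translate_start[OF assms] correction_def)

text \<open>Complementary to the previous estimate: cancellation happens only where the minimum
  equals \<Phi>, and elsewhere the correction is just \<open>target\<close>.\<close>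

lemma norm_correction_le:
  assumes "k \<in> arcs G" "s \<in> {0..<1}"
  shows "norm (correction k s) * Phi1 G \<rho> k t s
    \<le> norm (target k s) * Phi1 G \<rho> k t s + norm (source_image k s) * min (\<rho> k s) (Phi1 G \<rho> k t s)"
proof (cases "Phi1 G \<rho> k t s < \<rho> k s")
  case True
  have "norm (correction k s) \<le> norm (target k s) + norm (source_image k s)"
    using True by (simp add: correction_def norm_triangle_ineq4)
  then have "norm (correction k s) * Phi1 G \<rho> k t s \<le> (norm (target k s) + norm (source_image k s)) * Phi1 G \<rho> k t s"
    by (rule mult_right_mono) (rule Phi1_nonneg[OF assms(1)])
  then show ?thesis using True by (simp add: distrib_right min_def)
next
  case False
  then show ?thesis using Phi1_nonneg[OF assms(1), of t s] weight_pos[OF assms] by (simp add: correction_def)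
qed

definition cost :: "real \<Rightarrow> ennreal" where
  "cost s = ennreal C * (ennreal (\<Sum>i\<in>K. Phi1 G \<rho> i t s + Psi1 G \<rho> i t s) * indicator E s)"

text \<open>Only ancestors of \<open>K\<close> contribute. For \<open>j\<close> in \<open>K\<close>
  with ancestor \<open>k\<close> the minimum is exactly \<open>Psi1 G \<rho> j t s\<close>, and each
  such \<open>j\<close> adds at most \<open>C\<close> to the image at \<open>k\<close>.\<close>

lemma source_image_cost:
  assumes s: "s \<in> {0..<1}"
  shows "(\<Sum>\<^sub>\<infinity>k\<in>arcs G. ennreal (norm (source_image k s) * min (\<rho> k s) (Phi1 G \<rho> k t s)))
    \<le> ennreal C * (ennreal (\<Sum>i\<in>K. Psi1 G \<rho> i t s) * indicator E s)" (is "?L \<le> _")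
proof (cases "s \<in> E")
  case False
  then have "source_image k s = 0" for k
    unfolding source_image_def by (intro sum.neutral) (simp add: source_frac[OF s])
  then show ?thesis by simp
next
  case True
  let ?a = "anc G (jump t s)"
  let ?m = "\<lambda>k. norm (source_image k s) * min (\<rho> k s) (Phi1 G \<rho> k t s)"
  have Q: "?a ` K \<subseteq> arcs G" using K anc_in_arcs by blast
  have "?L = (\<Sum>\<^sub>\<infinity>k\<in>?a ` K. ennreal (?m k))"
  proof (rule infsum_cong_neutral)
    fix k assume "k \<in> arcs G - ?a ` K"
    then have "source_image k s = 0" unfolding source_image_def by (intro sum.neutral) auto
    then show "ennreal (?m k) = 0" by simp
  qed (use Q in auto)
  also have "\<dots> = (\<Sum>k\<in>?a ` K. ennreal (?m k))" using K by simp
  also have "\<dots> \<le> (\<Sum>k\<in>?a ` K. ennreal (\<Sum>j\<in>{j \<in> K. ?a j = k}. C * Psi1 G \<rho> j t s))"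
  proof (intro sum_mono ennreal_leI)
    fix k assume "k \<in> ?a ` K"
    then have k: "k \<in> arcs G" using Q by blast
    have m0: "0 \<le> min (\<rho> k s) (Phi1 G \<rho> k t s)"
      using weight_pos[OF k s] Phi1_nonneg[OF k, of t s] by simp
    have "source_image k s = (\<Sum>j\<in>{j \<in> K. ?a j = k}. source j (frac (t + s)))"
      unfolding source_image_def using K by (simp add: sum.inter_filter)
    then have "norm (source_image k s) \<le> (\<Sum>j\<in>{j \<in> K. ?a j = k}. norm (source j (frac (t + s))))"
      by (simp add: norm_sum)
    also have "\<dots> \<le> (\<Sum>j\<in>{j \<in> K. ?a j = k}. C)"
      using True f_bound by (intro sum_mono) (auto simp: source_frac[OF s])
    finally have "?m k \<le> (\<Sum>j\<in>{j \<in> K. ?a j = k}. C) * min (\<rho> k s) (Phi1 G \<rho> k t s)"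
      using m0 by (rule mult_right_mono)
    also have "\<dots> = (\<Sum>j\<in>{j \<in> K. ?a j = k}. C * Psi1 G \<rho> j t s)"
      unfolding sum_distrib_right by (intro sum.cong) (auto simp: Psi1_def Phi1_def)
    finally show "?m k \<le> (\<Sum>j\<in>{j \<in> K. ?a j = k}. C * Psi1 G \<rho> j t s)" .
  qed
  also have "\<dots> = ennreal (\<Sum>k\<in>?a ` K. \<Sum>j\<in>{j \<in> K. ?a j = k}. C * Psi1 G \<rho> j t s)"
    using K C Psi1_nonneg[OF _ s] by (intro sum_ennreal sum_nonneg mult_nonneg_nonneg) auto
  \<comment> \<open>The fibres of the ancestor map partition \<open>K\<close>.\<close>
  also have "(\<Sum>k\<in>?a ` K. \<Sum>j\<in>{j \<in> K. ?a j = k}. C * Psi1 G \<rho> j t s) = (\<Sum>j\<in>K. C * Psi1 G \<rho> j t s)"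
    using K(1) by (rule sum.image_gen[symmetric])
  also have "ennreal \<dots> = ennreal C * (ennreal (\<Sum>i\<in>K. Psi1 G \<rho> i t s) * indicator E s)"
    using True C K Psi1_nonneg[OF _ s] by (simp add: sum_distrib_left[symmetric] ennreal_mult' )
  finally show ?thesis .
qed

lemma target_cost:
  assumes s: "s \<in> {0..<1}"
  shows "(\<Sum>\<^sub>\<infinity>k\<in>arcs G. ennreal (norm (target k s) * Phi1 G \<rho> k t s))
    \<le> ennreal C * (ennreal (\<Sum>i\<in>K. Phi1 G \<rho> i t s) * indicator E s)" (is "?L \<le> _")
proof (cases "s \<in> E")
  case False
  then show ?thesis by (simp add: target_def)
next
  case True
  have "?L = (\<Sum>\<^sub>\<infinity>k\<in>K. ennreal (norm (target k s) * Phi1 G \<rho> k t s))"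
    using K by (intro infsum_cong_neutral) (auto simp: target_def)
  also have "\<dots> = (\<Sum>k\<in>K. ennreal (norm (target k s) * Phi1 G \<rho> k t s))" using K by simp
  also have "\<dots> \<le> (\<Sum>k\<in>K. ennreal (C * Phi1 G \<rho> k t s))"
    using True K g_bound Phi1_nonneg
    by (intro sum_mono ennreal_leI mult_right_mono) (auto simp: target_def)
  also have "\<dots> = ennreal (\<Sum>k\<in>K. C * Phi1 G \<rho> k t s)"
    using K C Phi1_nonneg by (intro sum_ennreal mult_nonneg_nonneg) auto
  also have "\<dots> = ennreal C * (ennreal (\<Sum>i\<in>K. Phi1 G \<rho> i t s) * indicator E s)"
    using True C by (simp add: sum_distrib_left[symmetric] ennreal_mult')
  finally show ?thesis .
qed

lemma cost_split:
  assumes s: "s \<in> {0..<1}"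
  shows "cost s = ennreal C * (ennreal (\<Sum>i\<in>K. Phi1 G \<rho> i t s) * indicator E s)
    + ennreal C * (ennreal (\<Sum>i\<in>K. Psi1 G \<rho> i t s) * indicator E s)"
proof -
  have "0 \<le> (\<Sum>i\<in>K. Phi1 G \<rho> i t s)" "0 \<le> (\<Sum>i\<in>K. Psi1 G \<rho> i t s)"
    using K s by (auto intro!: sum_nonneg Phi1_nonneg Psi1_nonneg)
  then show ?thesis by (simp add: cost_def sum.distrib distrib_left distrib_right)
qed

lemma mass_translate_start_diff:
  assumes s: "s \<in> {0..<1}"
  shows "mass (\<lambda>k s. translate_family G t start k s - target k s) s \<le> cost s"
proof -
  have "mass (\<lambda>k s. translate_family G t start k s - target k s) s
      \<le> (\<Sum>\<^sub>\<infinity>k\<in>arcs G. ennreal (norm (source_image k s) * min (\<rho> k s) (Phi1 G \<rho> k t s)))"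
    unfolding mass_def
    by (intro infsum_mono ennreal_leI norm_translate_start_diff s) (simp_all add: nonneg_summable_on_complete)
  also have "\<dots> \<le> cost s"
    using source_image_cost[OF s] unfolding cost_split[OF s] by (rule order_trans) simp
  finally show ?thesis .
qed

text \<open>\<open>k\<close> is recovered from its light descendant as the ancestor, so the sum over
  edges reindexes to a sum over all \<open>k\<close>. The factor 2 is the one in the choice of
  \<open>light_desc\<close>.\<close>

lemma mass_push:
  assumes s: "s \<in> {0..<1}"
  shows "mass push (frac (t + s)) \<le> 2 * cost s"
proof -
  let ?u = "frac (t + s)"
  let ?l = "light_desc t s"
  have l: "?l k \<in> desc G (jump t s) k" if "k \<in> arcs G" for k using light_desc_in[OF that t s] .
  then have la: "?l k \<in> arcs G" "anc G (jump t s) (?l k) = k" if "k \<in> arcs G" for k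
    using that desc_in_arcs anc_eq by blast+
  have "inj_on ?l (arcs G)" by (rule inj_onI) (metis la(2))
  have "mass push ?u = (\<Sum>\<^sub>\<infinity>j\<in>?l ` arcs G. ennreal (norm (push j ?u) * \<rho> j ?u))"
    unfolding mass_def
  proof (rule infsum_cong_neutral)
    fix j assume j: "j \<in> arcs G - ?l ` arcs G"
    then have "anc G (jump t s) j \<in> arcs G" using anc_in_arcs by blast
    then have "?l (anc G (jump t s) j) \<noteq> j" using j by (metis DiffD2 image_eqI)
    then have "push j ?u = 0" by (simp add: push_frac[OF s])
    then show "ennreal (norm (push j ?u) * \<rho> j ?u) = 0" by simp
  qed (use la in auto)
  also have "\<dots> = (\<Sum>\<^sub>\<infinity>k\<in>arcs G. ennreal (norm (correction k s) * \<rho> (?l k) ?u))"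
    unfolding infsum_reindex[OF \<open>inj_on ?l (arcs G)\<close>] o_def
    by (intro infsum_cong) (simp add: push_frac[OF s] la)
  also have "\<dots> \<le> (\<Sum>\<^sub>\<infinity>k\<in>arcs G. 2 * (ennreal (norm (target k s) * Phi1 G \<rho> k t s)
      + ennreal (norm (source_image k s) * min (\<rho> k s) (Phi1 G \<rho> k t s))))"
  proof (rule infsum_mono)
    fix k assume k: "k \<in> arcs G"
    have p: "0 \<le> Phi1 G \<rho> k t s" "0 \<le> \<rho> k s" using Phi1_nonneg[OF k] weight_pos[OF k s] by auto
    have "norm (correction k s) * \<rho> (?l k) ?u \<le> norm (correction k s) * (2 * Phi1 G \<rho> k t s)"
      by (intro mult_left_mono light_desc_le k t s) simp
    also have "\<dots> \<le> 2 * (norm (target k s) * Phi1 G \<rho> k t s + norm (source_image k s) * min (\<rho> k s) (Phi1 G \<rho> k t s))"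
      using norm_correction_le[OF k s] by simp
    finally have "ennreal (norm (correction k s) * \<rho> (?l k) ?u) \<le> ennreal (2 *
        (norm (target k s) * Phi1 G \<rho> k t s + norm (source_image k s) * min (\<rho> k s) (Phi1 G \<rho> k t s)))"
      by (rule ennreal_leI)
    also have "\<dots> = 2 * (ennreal (norm (target k s) * Phi1 G \<rho> k t s)
      + ennreal (norm (source_image k s) * min (\<rho> k s) (Phi1 G \<rho> k t s)))"
      using p by (subst ennreal_mult) (auto simp: ennreal_plus)
    finally show "ennreal (norm (correction k s) * \<rho> (?l k) ?u) \<le> 2 * (ennreal (norm (target k s) * Phi1 G \<rho> k t s)
      + ennreal (norm (source_image k s) * min (\<rho> k s) (Phi1 G \<rho> k t s)))" .
  qed (simp_all add: nonneg_summable_on_complete)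
  also have "\<dots> = 2 * (\<Sum>\<^sub>\<infinity>k\<in>arcs G. ennreal (norm (target k s) * Phi1 G \<rho> k t s)
      + ennreal (norm (source_image k s) * min (\<rho> k s) (Phi1 G \<rho> k t s)))"
    unfolding infsum_eq_nn_integral_count_space[OF countable_arcs] by (rule nn_integral_cmult) simp
  also have "\<dots> = 2 * ((\<Sum>\<^sub>\<infinity>k\<in>arcs G. ennreal (norm (target k s) * Phi1 G \<rho> k t s))
      + (\<Sum>\<^sub>\<infinity>k\<in>arcs G. ennreal (norm (source_image k s) * min (\<rho> k s) (Phi1 G \<rho> k t s))))"
    by (subst infsum_add) (simp_all add: nonneg_summable_on_complete)
  also have "\<dots> \<le> 2 * cost s"
    unfolding cost_split[OF s] by (intro mult_left_mono add_mono source_image_cost target_cost s) simp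
  finally show ?thesis .
qed

section \<open>Measurability and norms of the transfer families\<close>

lemma source_measurable: "measurable_family source"
  unfolding measurable_family_def
proof
  fix j assume j: "j \<in> arcs G"
  have [measurable]: "f j \<in> borel_measurable unit_lebesgue" using mf j by (simp add: measurable_family_def)
  have E': "{u \<in> space unit_lebesgue. frac (- t + u) \<in> E} \<in> sets unit_lebesgue"
    using measurable_sets[OF frac_translation_measurable E, of "- t"] by (simp add: vimage_def Int_def conj_commute)
  have "(\<lambda>u. if frac (- t + u) \<in> E then f j u else 0) \<in> borel_measurable unit_lebesgue"
    by (rule measurable_If[OF _ _ E']) auto
  then show "source j \<in> borel_measurable unit_lebesgue"
    unfolding source_def[abs_def] by (cases "j \<in> K") simp_all
qed

lemma target_measurable: "measurable_family target"
  unfolding measurable_family_def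
proof
  fix j assume j: "j \<in> arcs G"
  have [measurable]: "g j \<in> borel_measurable unit_lebesgue" using mf j by (simp add: measurable_family_def)
  have "{s \<in> space unit_lebesgue. s \<in> E} = E" using E_unit by auto
  then have E': "{s \<in> space unit_lebesgue. s \<in> E} \<in> sets unit_lebesgue" using E by simp
  have "(\<lambda>s. if s \<in> E then g j s else 0) \<in> borel_measurable unit_lebesgue"
    by (rule measurable_If[OF _ _ E']) auto
  then show "target j \<in> borel_measurable unit_lebesgue"
    unfolding target_def[abs_def] by (cases "j \<in> K") simp_all
qed

lemma source_image_measurable: "source_image k \<in> borel_measurable unit_lebesgue"
proof -
  have "(\<lambda>s. \<Sum>j\<in>K. if anc G n j = k then source j (frac (t + s)) else 0) \<in> borel_measurable unit_lebesgue" for n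
  proof (rule borel_measurable_sum)
    fix j assume "j \<in> K"
    then have "source j \<in> borel_measurable unit_lebesgue"
      using source_measurable K by (auto simp: measurable_family_def)
    then have "(\<lambda>s. source j (frac (t + s))) \<in> borel_measurable unit_lebesgue"
      by (rule frac_translated_measurable)
    then show "(\<lambda>s. if anc G n j = k then source j (frac (t + s)) else 0) \<in> borel_measurable unit_lebesgue"
      by simp
  qed
  then show ?thesis unfolding source_image_def[abs_def] by (rule jump_dependent_measurable)
qed

lemma correction_measurable:
  assumes k: "k \<in> arcs G" shows "correction k \<in> borel_measurable unit_lebesgue"
proof -
  have [measurable]: "target k \<in> borel_measurable unit_lebesgue" "source_image k \<in> borel_measurable unit_lebesgue"
    "\<rho> k \<in> borel_measurable unit_lebesgue" "Phi1 G \<rho> k t \<in> borel_measurable unit_lebesgue"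
    using target_measurable source_image_measurable weight_measurable[OF k] Phi1_measurable[OF k] k
    by (auto simp: measurable_family_def)
  show ?thesis unfolding correction_def[abs_def] by measurable
qed

lemma push_measurable: "measurable_family push"
  unfolding measurable_family_def
proof
  fix j assume j: "j \<in> arcs G"
  have "(\<lambda>s. if light_desc t s (anc G n j) = j then correction (anc G n j) s else 0) \<in> borel_measurable unit_lebesgue" for n
  proof (rule measurable_If)
    have a: "anc G n j \<in> arcs G" using j by (rule anc_in_arcs)
    show "(\<lambda>s. correction (anc G n j) s) \<in> borel_measurable unit_lebesgue"
      using correction_measurable[OF a] by simp
    show "{s \<in> space unit_lebesgue. light_desc t s (anc G n j) = j} \<in> sets unit_lebesgue"
      using measurable_sets[OF light_desc_measurable[OF a, of t], of "{j}"]
      by (simp add: vimage_def Int_def conj_commute)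
  qed simp
  then have "(\<lambda>s. if light_desc t s (anc G (jump t s) j) = j then correction (anc G (jump t s) j) s else 0)
      \<in> borel_measurable unit_lebesgue"
    by (rule jump_dependent_measurable)
  \<comment> \<open>\<open>push j\<close> is the preceding function of \<open>s\<close> composed
    with the rotation by \<open>- t\<close>.\<close>
  then show "push j \<in> borel_measurable unit_lebesgue"
    unfolding push_def[abs_def] Let_def by (rule frac_translated_measurable)
qed

lemma start_measurable: "measurable_family start"
  using source_measurable push_measurable unfolding measurable_family_def start_def[abs_def]
  by (simp add: borel_measurable_add)

lemma translate_start_measurable: "measurable_family (translate_family G t start)"
  unfolding measurable_family_def
proof
  fix k assume k: "k \<in> arcs G"
  have "(\<lambda>s. source_image k s + correction k s) \<in> borel_measurable unit_lebesgue"
    using source_image_measurable correction_measurable[OF k] by simp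
  moreover have "translate_family G t start k s = source_image k s + correction k s"
    if "s \<in> space unit_lebesgue" for s
    using translate_start[OF k, of s] that by simp
  ultimately show "translate_family G t start k \<in> borel_measurable unit_lebesgue"
    by (subst measurable_cong[where g = "\<lambda>s. source_image k s + correction k s"])
qed

lemma cost_integral:
  "(\<integral>\<^sup>+s. cost s \<partial>unit_lebesgue)
    = ennreal C * (\<integral>\<^sup>+s. ennreal (\<Sum>i\<in>K. Phi1 G \<rho> i t s + Psi1 G \<rho> i t s) * indicator E s \<partial>unit_lebesgue)"
  and cost_measurable: "cost \<in> borel_measurable unit_lebesgue"
proof -
  have "(\<lambda>s. \<Sum>i\<in>K. Phi1 G \<rho> i t s + Psi1 G \<rho> i t s) \<in> borel_measurable unit_lebesgue"
    using K by (intro borel_measurable_sum borel_measurable_add Phi1_measurable Psi1_measurable) auto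
  then have m: "(\<lambda>s. ennreal (\<Sum>i\<in>K. Phi1 G \<rho> i t s + Psi1 G \<rho> i t s) * indicator E s) \<in> borel_measurable unit_lebesgue"
    using E by (intro borel_measurable_times_ennreal borel_measurable_indicator) auto
  show "(\<integral>\<^sup>+s. cost s \<partial>unit_lebesgue)
    = ennreal C * (\<integral>\<^sup>+s. ennreal (\<Sum>i\<in>K. Phi1 G \<rho> i t s + Psi1 G \<rho> i t s) * indicator E s \<partial>unit_lebesgue)"
    unfolding cost_def by (rule nn_integral_cmult[OF m])
  show "cost \<in> borel_measurable unit_lebesgue"
    unfolding cost_def[abs_def] by (rule borel_measurable_times_ennreal[OF _ m]) simp
qed

text \<open>Invariance under rotation replaces the integration variable \<open>u\<close> by
  \<open>frac (t + s)\<close>, where the pointwise bound is available.\<close>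

lemma L1_norm_push: "L1_norm G \<rho> push \<le> 2 * (\<integral>\<^sup>+s. cost s \<partial>unit_lebesgue)"
proof -
  have "L1_norm G \<rho> push = (\<integral>\<^sup>+s. mass push (frac (t + s)) \<partial>unit_lebesgue)"
    by (simp add: L1_norm_eq_integral_mass push_measurable nn_integral_frac_translation mass_measurable)
  also have "\<dots> \<le> (\<integral>\<^sup>+s. 2 * cost s \<partial>unit_lebesgue)"
    by (intro nn_integral_mono mass_push) simp
  also have "\<dots> = 2 * (\<integral>\<^sup>+s. cost s \<partial>unit_lebesgue)"
    by (rule nn_integral_cmult[OF cost_measurable])
  finally show ?thesis .
qed

lemma L1_norm_translate_start_diff:
  "L1_norm G \<rho> (\<lambda>k s. translate_family G t start k s - target k s) \<le> (\<integral>\<^sup>+s. cost s \<partial>unit_lebesgue)"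
  unfolding L1_norm_eq_integral_mass[OF measurable_family_diff[OF translate_start_measurable target_measurable]]
  by (intro nn_integral_mono mass_translate_start_diff) simp

end

section \<open>Almost everywhere equality and translation of classes\<close>

lemma ennreal_add_less_le:
  fixes a b c d :: ennreal
  assumes "a < c" "b \<le> d" "d < top" shows "a + b < c + d"
proof -
  have "a + b \<le> a + d" using assms(2) by (rule add_left_mono)
  also have "\<dots> < c + d" using assms(1,3) by (simp add: ennreal_add_left_cancel_less add.commute[of _ d])
  finally show ?thesis .
qed

text \<open>Rests on completeness of Lebesgue measure, applied to the functions extended by
  \<open>0\<close>.\<close>

lemma measurable_AE_eq_unit_lebesgue:
  fixes f g :: "real \<Rightarrow> 'b::euclidean_space"
  assumes "f \<in> borel_measurable unit_lebesgue" "AE s in unit_lebesgue. f s = g s"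
  shows "g \<in> borel_measurable unit_lebesgue"
proof -
  have "(\<lambda>x. indicat_real {0..<1} x *\<^sub>R f x) \<in> borel_measurable lebesgue"
    using assms(1) by (simp add: borel_measurable_restrict_space_iff)
  moreover have "AE x in lebesgue. x \<in> {0..<1} \<longrightarrow> f x = g x"
    using assms(2) by (simp add: AE_restrict_space_iff)
  then have "AE x in lebesgue. indicat_real {0..<1} x *\<^sub>R f x = indicat_real {0..<1} x *\<^sub>R g x"
    by eventually_elim (auto simp: indicator_def)
  ultimately have "(\<lambda>x. indicat_real {0..<1} x *\<^sub>R g x) \<in> borel_measurable lebesgue"
    by (rule borel_measurable_AE)
  then show ?thesis by (simp add: borel_measurable_restrict_space_iff)
qed

lemma emeasure_frac_translation_vimage:
  assumes "B \<in> sets unit_lebesgue"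
  shows "{s \<in> {0..<1}. frac (c + s) \<in> B} \<in> sets unit_lebesgue"
    and "emeasure unit_lebesgue {s \<in> {0..<1}. frac (c + s) \<in> B} = emeasure unit_lebesgue B"
proof -
  have eq: "(\<lambda>s. frac (c + s)) -` B \<inter> space unit_lebesgue = {s \<in> {0..<1}. frac (c + s) \<in> B}" by auto
  show "{s \<in> {0..<1}. frac (c + s) \<in> B} \<in> sets unit_lebesgue"
    using measurable_sets[OF frac_translation_measurable assms, of c] unfolding eq .
  show "emeasure unit_lebesgue {s \<in> {0..<1}. frac (c + s) \<in> B} = emeasure unit_lebesgue B"
    using emeasure_distr[OF frac_translation_measurable assms, of c]
    unfolding eq distr_frac_translation by simp
qed

context weighted_tree
begin

lemma L1_families_near:
  assumes "f \<in> L1_families G \<rho>" "measurable_family h" "L1_norm G \<rho> (\<lambda>i s. f i s - h i s) < \<infinity>"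
  shows "h \<in> L1_families G \<rho>"
proof -
  have "norm (h i s) \<le> norm (f i s) + norm (f i s - h i s)" for i s
    using norm_triangle_sub[of "h i s" "f i s"] by (simp add: norm_minus_commute)
  then have "L1_norm G \<rho> h \<le> L1_norm G \<rho> f + L1_norm G \<rho> (\<lambda>i s. f i s - h i s)"
    using assms by (intro L1_norm_triangle) (auto simp: L1_families_iff measurable_family_diff)
  also have "\<dots> < \<infinity>" using assms by (simp add: L1_families_iff)
  finally show ?thesis using assms by (simp add: L1_families_iff)
qed

text \<open>Countability of the edges yields one null set for all of them, and the rotation pulls
  null sets back to null sets.\<close>

lemma translate_family_cong_AE:
  fixes f h :: "'i \<Rightarrow> real \<Rightarrow> 'k::{real_normed_field, euclidean_space}"
  assumes "\<And>i. i \<in> arcs G \<Longrightarrow> AE u in unit_lebesgue. f i u = h i u" "k \<in> arcs G"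
  shows "AE s in unit_lebesgue. translate_family G t f k s = translate_family G t h k s"
proof -
  have "AE u in unit_lebesgue. \<forall>i\<in>arcs G. f i u = h i u"
    using assms(1) countable_arcs by (simp add: AE_ball_countable)
  then have "AE s in unit_lebesgue. \<forall>i\<in>arcs G. f i (frac (t + s)) = h i (frac (t + s))"
    by (rule AE_frac_translation)
  then show ?thesis
  proof eventually_elim
    case (elim s)
    then show ?case
      unfolding translate_family_def using desc_in_arcs[OF assms(2)] by (intro infsum_cong) auto
  qed
qed

text \<open>\<open>left_translation\<close> acts on a chosen representative; this makes it
  computable on any given one, such as \<open>start\<close> below.\<close>

lemma left_translation_class:
  fixes h :: "'i \<Rightarrow> real \<Rightarrow> 'k::{real_normed_field, euclidean_space}"
  assumes h: "h \<in> L1_families G \<rho>" and Th: "translate_family G t h \<in> L1_families G \<rho>"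
  shows "left_translation G \<rho> t (L1_eq G \<rho> `` {h}) = L1_eq G \<rho> `` {translate_family G t h}"
proof -
  let ?r = "rep (L1_eq G \<rho> `` {h})"
  have "AE s in unit_lebesgue. h i s = ?r i s" if "i \<in> arcs G" for i
    using rep_class_AE[OF h that] by eventually_elim simp
  then have ae: "AE s in unit_lebesgue. translate_family G t h i s = translate_family G t ?r i s" if "i \<in> arcs G" for i
    using that by (rule translate_family_cong_AE)
  have "measurable_family (translate_family G t ?r)"
    using Th measurable_AE_eq_unit_lebesgue[OF _ ae] by (auto simp: measurable_family_def L1_families_iff)
  moreover have "L1_norm G \<rho> (translate_family G t ?r) = L1_norm G \<rho> (translate_family G t h)"
    by (rule sym, rule L1_norm_cong_AE) (rule ae)
  ultimately have "(translate_family G t h, translate_family G t ?r) \<in> L1_eq G \<rho>"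
    using Th ae by (simp add: L1_eq_def L1_families_iff)
  then show ?thesis
    unfolding left_translation_def using equiv_class_eq[OF equiv_L1_eq] by metis
qed

end

context admissible_tree
begin

lemma N1_imp_transitive:
  assumes N1: "\<And>K \<epsilon> \<alpha>. finite K \<Longrightarrow> K \<noteq> {} \<Longrightarrow> K \<subseteq> arcs G \<Longrightarrow> 0 < \<epsilon> \<Longrightarrow> 0 < \<alpha> \<Longrightarrow> \<alpha> < 1 \<Longrightarrow> N1 G \<rho> K \<epsilon> \<alpha> \<in> \<F>"
    and \<F>: "furstenberg_family \<F>"
  shows "family_transitive \<F> (L1_topology G \<rho> :: ('i \<Rightarrow> real \<Rightarrow> 'k::{real_normed_field, euclidean_space}) set topology)
    (left_translation G \<rho>)"
  unfolding family_transitive_def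
proof (intro allI impI, elim conjE)
  interpret prob: finite_measure unit_lebesgue by (rule finite_measure_unit_lebesgue)
  fix U V :: "('i \<Rightarrow> real \<Rightarrow> 'k) set set"
  assume U: "openin (L1_topology G \<rho>) U" "U \<noteq> {}" and V: "openin (L1_topology G \<rho>) V" "V \<noteq> {}"
  obtain f \<delta>1 where f: "f \<in> L1_families G \<rho>" "\<delta>1 > 0"
    "\<And>h. h \<in> L1_families G \<rho> \<Longrightarrow> L1_norm G \<rho> (\<lambda>i s. f i s - h i s) < ennreal \<delta>1 \<Longrightarrow> L1_eq G \<rho> `` {h} \<in> U"
    using openin_L1_ball[OF U] by blast
  obtain g \<delta>2 where g: "g \<in> L1_families G \<rho>" "\<delta>2 > 0"
    "\<And>h. h \<in> L1_families G \<rho> \<Longrightarrow> L1_norm G \<rho> (\<lambda>i s. g i s - h i s) < ennreal \<delta>2 \<Longrightarrow> L1_eq G \<rho> `` {h} \<in> V"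
    using openin_L1_ball[OF V] by blast
  define \<delta> where "\<delta> = min \<delta>1 \<delta>2"
  have \<delta>: "\<delta> > 0" "\<delta> \<le> \<delta>1" "\<delta> \<le> \<delta>2" "\<delta> / 2 > 0" using f(2) g(2) by (auto simp: \<delta>_def)
  obtain K1 where K1: "finite K1" "K1 \<subseteq> arcs G"
    "\<And>K. finite K \<Longrightarrow> K1 \<subseteq> K \<Longrightarrow> K \<subseteq> arcs G \<Longrightarrow> \<exists>\<eta>>0. \<forall>A\<in>sets unit_lebesgue.
      emeasure unit_lebesgue A < ennreal \<eta> \<longrightarrow> L1_norm G \<rho> (\<lambda>i s. if i \<in> K \<and> s \<notin> A then 0 else f i s) < ennreal (\<delta> / 2)"
  proof (rule L1_norm_truncation_small[OF f(1) \<delta>(4)], goal_cases)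
    case (1 K0)
    show ?case by (rule 1(1)[OF 1(2,3)]) (rule 1(4))
  qed
  obtain K2 where K2: "finite K2" "K2 \<subseteq> arcs G"
    "\<And>K. finite K \<Longrightarrow> K2 \<subseteq> K \<Longrightarrow> K \<subseteq> arcs G \<Longrightarrow> \<exists>\<eta>>0. \<forall>A\<in>sets unit_lebesgue.
      emeasure unit_lebesgue A < ennreal \<eta> \<longrightarrow> L1_norm G \<rho> (\<lambda>i s. if i \<in> K \<and> s \<notin> A then 0 else g i s) < ennreal (\<delta> / 2)"
  proof (rule L1_norm_truncation_small[OF g(1) \<delta>(4)], goal_cases)
    case (1 K0)
    show ?case by (rule 1(1)[OF 1(2,3)]) (rule 1(4))
  qed
  obtain a where a: "a \<in> arcs G" using arcs_nonempty by blast
  \<comment> \<open>One \<open>K\<close> for both truncations; the extra edge \<open>a\<close> keeps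
    it nonempty.\<close>
  define K where "K = insert a (K1 \<union> K2)"
  have K: "finite K" "K \<noteq> {}" "K \<subseteq> arcs G" "K1 \<subseteq> K" "K2 \<subseteq> K" using K1 K2 a by (auto simp: K_def)
  obtain \<eta>1 where \<eta>1: "\<eta>1 > 0" "\<forall>A\<in>sets unit_lebesgue. emeasure unit_lebesgue A < ennreal \<eta>1 \<longrightarrow>
      L1_norm G \<rho> (\<lambda>i s. if i \<in> K \<and> s \<notin> A then 0 else f i s) < ennreal (\<delta> / 2)"
    using K1(3)[OF K(1,4,3)] by blast
  obtain \<eta>2 where \<eta>2: "\<eta>2 > 0" "\<forall>A\<in>sets unit_lebesgue. emeasure unit_lebesgue A < ennreal \<eta>2 \<longrightarrow>
      L1_norm G \<rho> (\<lambda>i s. if i \<in> K \<and> s \<notin> A then 0 else g i s) < ennreal (\<delta> / 2)"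
    using K2(3)[OF K(1,5,3)] by blast
  define \<eta> where "\<eta> = min \<eta>1 \<eta>2"
  have \<eta>: "0 < \<eta>" "\<eta> \<le> \<eta>1" "\<eta> \<le> \<eta>2" using \<eta>1(1) \<eta>2(1) by (auto simp: \<eta>_def)
  have mf: "measurable_family f" "measurable_family g" using f(1) g(1) by (simp_all add: L1_families_iff)
  \<comment> \<open>The given families need not be bounded, but on the finitely many edges of
    \<open>K\<close> each is, off a set of measure below \<open>\<eta> / 4\<close>.\<close>
  have bound: "\<exists>C B. C > 0 \<and> B \<in> sets unit_lebesgue \<and> measure unit_lebesgue B > 1 - \<eta> / 4 \<and> (\<forall>s\<in>B. \<forall>i\<in>K. norm (h i s) \<le> C)"
    if "measurable_family h" for h :: "'i \<Rightarrow> real \<Rightarrow> 'k"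
  proof -
    have "(\<lambda>s. norm (h i s)) \<in> borel_measurable unit_lebesgue" if "i \<in> K" for i
    proof -
      have [measurable]: "h i \<in> borel_measurable unit_lebesgue"
        using \<open>measurable_family h\<close> K(3) that by (auto simp: measurable_family_def)
      show ?thesis by measurable
    qed
    then obtain C where "C > 0" "{s \<in> {0..<1}. \<forall>i\<in>K. norm (h i s) \<le> C} \<in> sets unit_lebesgue"
      "measure unit_lebesgue {s \<in> {0..<1}. \<forall>i\<in>K. norm (h i s) \<le> C} > 1 - \<eta> / 4"
      using bounded_on_large_set[OF K(1), of "\<lambda>i s. norm (h i s)" "\<eta> / 4"] \<eta>(1) by auto
    then show ?thesis
      by (intro exI[of _ C] exI[of _ "{s \<in> {0..<1}. \<forall>i\<in>K. norm (h i s) \<le> C}"]) auto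
  qed
  obtain C1 B1 where B1: "C1 > 0" "B1 \<in> sets unit_lebesgue" "measure unit_lebesgue B1 > 1 - \<eta> / 4"
    "\<forall>s\<in>B1. \<forall>i\<in>K. norm (f i s) \<le> C1" using bound[OF mf(1)] by blast
  obtain C2 B2 where B2: "C2 > 0" "B2 \<in> sets unit_lebesgue" "measure unit_lebesgue B2 > 1 - \<eta> / 4"
    "\<forall>s\<in>B2. \<forall>i\<in>K. norm (g i s) \<le> C2" using bound[OF mf(2)] by blast
  define C where "C = max C1 C2"
  have C: "0 < C" "C1 \<le> C" "C2 \<le> C" using B1(1) by (auto simp: C_def)
  \<comment> \<open>Chosen so that \<open>push\<close>, whose norm is at most twice the integral of
    \<open>cost\<close>, stays within \<open>\<delta> / 2\<close>.\<close>
  define \<epsilon> where "\<epsilon> = \<delta> / (4 * C)"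
  \<comment> \<open>The entry \<open>1 / 2\<close> keeps \<open>\<alpha>\<close> positive when
    \<open>\<eta>\<close> is large.\<close>
  define \<alpha> where "\<alpha> = max (1 / 2) (1 - \<eta> / 4)"
  have \<epsilon>: "0 < \<epsilon>" "2 * (C * \<epsilon>) = \<delta> / 2" using \<delta>(1) C(1) by (auto simp: \<epsilon>_def)
  have \<alpha>: "0 < \<alpha>" "\<alpha> < 1" "1 - \<eta> / 4 \<le> \<alpha>" using \<eta>(1) by (auto simp: \<alpha>_def)
  have "N1 G \<rho> K \<epsilon> \<alpha> \<subseteq> hitting_times (left_translation G \<rho>) U V"
  proof
    fix t assume tN: "t \<in> N1 G \<rho> K \<epsilon> \<alpha>"
    then have t: "0 \<le> t" by (simp add: N1_def)
    obtain E0 where E0: "E0 \<in> sets unit_lebesgue" "measure unit_lebesgue E0 > \<alpha>"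
      "(\<integral>\<^sup>+s. ennreal (\<Sum>i\<in>K. Phi1 G \<rho> i t s + Psi1 G \<rho> i t s) * indicator E0 s \<partial>unit_lebesgue) < ennreal \<epsilon>"
      using N1_memD[OF tN K(1,3) \<alpha>(2)] by blast
    \<comment> \<open>\<open>f\<close> is evaluated at \<open>frac (t + s)\<close>, so its good set
      is pulled back along the rotation, which preserves the measure.\<close>
    define B1' where "B1' = {s \<in> {0..<1}. frac (t + s) \<in> B1}"
    have B1': "B1' \<in> sets unit_lebesgue" "measure unit_lebesgue B1' = measure unit_lebesgue B1"
      using emeasure_frac_translation_vimage[OF B1(2), of t] by (simp_all add: B1'_def measure_def)
    define E where "E = E0 \<inter> B1' \<inter> B2"
    have E: "E \<in> sets unit_lebesgue" using E0(1) B1'(1) B2(2) by (auto simp: E_def)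
    define A where "A = space unit_lebesgue - E"
    have A: "A \<in> sets unit_lebesgue" using E by (auto simp: A_def)
    have sp: "measure unit_lebesgue (space unit_lebesgue) = 1"
      using emeasure_unit_lebesgue_space by (simp add: measure_def)
    have "A = (space unit_lebesgue - E0) \<union> (space unit_lebesgue - B1') \<union> (space unit_lebesgue - B2)"
      by (auto simp: A_def E_def)
    then have "measure unit_lebesgue A \<le> measure unit_lebesgue (space unit_lebesgue - E0)
        + measure unit_lebesgue (space unit_lebesgue - B1') + measure unit_lebesgue (space unit_lebesgue - B2)"
      using E0(1) B1'(1) B2(2) by (auto intro!: order_trans[OF measure_Un_le] add_right_mono)
    also have "\<dots> = (1 - measure unit_lebesgue E0) + (1 - measure unit_lebesgue B1) + (1 - measure unit_lebesgue B2)"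
      using prob.finite_measure_compl[OF E0(1)] prob.finite_measure_compl[OF B1'(1)]
        prob.finite_measure_compl[OF B2(2)] sp B1'(2) by simp
    \<comment> \<open>Each of the three complements has measure below
      \<open>\<eta> / 4\<close>.\<close>
    also have "\<dots> < \<eta>" using E0(2) \<alpha>(3) B1(3) B2(3) \<eta>(1) by simp
    finally have mA: "emeasure unit_lebesgue A < ennreal \<eta>"
      by (simp add: prob.emeasure_eq_measure ennreal_less_iff)
    interpret transfer G \<rho> K E t C f g
    proof
      show "norm (f j (frac (t + s))) \<le> C" if "j \<in> K" "s \<in> E" for j s
        using that B1(4) C(2) by (fastforce simp: E_def B1'_def)
      show "norm (g j s) \<le> C" if "j \<in> K" "s \<in> E" for j s
        using that B2(4) C(3) by (fastforce simp: E_def)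
    qed (use K E t C mf in auto)
    have "(\<integral>\<^sup>+s. ennreal (\<Sum>i\<in>K. Phi1 G \<rho> i t s + Psi1 G \<rho> i t s) * indicator E s \<partial>unit_lebesgue)
      \<le> (\<integral>\<^sup>+s. ennreal (\<Sum>i\<in>K. Phi1 G \<rho> i t s + Psi1 G \<rho> i t s) * indicator E0 s \<partial>unit_lebesgue)"
      by (intro nn_integral_mono) (auto simp: E_def indicator_def)
    also have "\<dots> \<le> ennreal \<epsilon>" using E0(3) by simp
    finally have "(\<integral>\<^sup>+s. cost s \<partial>unit_lebesgue) \<le> ennreal C * ennreal \<epsilon>"
      unfolding cost_integral by (intro mult_left_mono) auto
    then have "2 * (\<integral>\<^sup>+s. cost s \<partial>unit_lebesgue) \<le> 2 * (ennreal C * ennreal \<epsilon>)"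
      by (intro mult_left_mono) auto
    also have "\<dots> = ennreal (2 * (C * \<epsilon>))"
      using C(1) \<epsilon>(1) by (simp add: ennreal_mult)
    finally have cost2: "2 * (\<integral>\<^sup>+s. cost s \<partial>unit_lebesgue) \<le> ennreal (\<delta> / 2)" unfolding \<epsilon>(2) .
    then have cost1: "(\<integral>\<^sup>+s. cost s \<partial>unit_lebesgue) \<le> ennreal (\<delta> / 2)"
      by (rule order_trans[rotated]) (simp add: mult_2)
    have half: "ennreal (\<delta> / 2) + ennreal (\<delta> / 2) = ennreal \<delta>" using \<delta>(1) by (simp flip: ennreal_plus)
    \<comment> \<open>The coordinates \<open>u\<close> at which the test in \<open>source\<close>
      fails. Rotation gives this set the measure of \<open>A\<close>, and \<open>f - source\<close>
      is then exactly a truncation error of \<open>f\<close>.\<close>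
    define A' where "A' = {u \<in> {0..<1}. frac (- t + u) \<in> A}"
    have A': "A' \<in> sets unit_lebesgue" "emeasure unit_lebesgue A' < ennreal \<eta>"
      using emeasure_frac_translation_vimage[OF A, of "- t"] mA by (simp_all add: A'_def)
    have f_source: "L1_norm G \<rho> (\<lambda>i s. f i s - source i s) < ennreal (\<delta> / 2)"
    proof -
      have "L1_norm G \<rho> (\<lambda>i s. f i s - source i s) = L1_norm G \<rho> (\<lambda>i s. if i \<in> K \<and> s \<notin> A' then 0 else f i s)"
        by (intro L1_norm_cong_AE AE_I2) (auto simp: source_def A'_def A_def frac_lt_1)
      also have "\<dots> < ennreal (\<delta> / 2)"
        using \<eta>1(2) A' \<eta>(2) by (meson ennreal_leI order.strict_trans2)
      finally show ?thesis .
    qed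
    have g_target: "L1_norm G \<rho> (\<lambda>i s. g i s - target i s) < ennreal (\<delta> / 2)"
    proof -
      have "L1_norm G \<rho> (\<lambda>i s. g i s - target i s) = L1_norm G \<rho> (\<lambda>i s. if i \<in> K \<and> s \<notin> A then 0 else g i s)"
        by (intro L1_norm_cong_AE AE_I2) (auto simp: target_def A_def)
      also have "\<dots> < ennreal (\<delta> / 2)"
        using \<eta>2(2) A mA \<eta>(3) by (meson ennreal_leI order.strict_trans2)
      finally show ?thesis .
    qed
    have f_start: "L1_norm G \<rho> (\<lambda>i s. f i s - start i s) < ennreal \<delta>"
    proof -
      have "L1_norm G \<rho> (\<lambda>i s. f i s - start i s) \<le> L1_norm G \<rho> (\<lambda>i s. f i s - source i s) + L1_norm G \<rho> push"
      proof (rule L1_norm_triangle)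
        show "norm (f i s - start i s) \<le> norm (f i s - source i s) + norm (push i s)" for i s
          using norm_triangle_ineq4[of "f i s - source i s" "push i s"] by (simp add: start_def diff_diff_eq)
      qed (auto intro: measurable_family_diff mf source_measurable start_measurable push_measurable)
      also have "\<dots> < ennreal (\<delta> / 2) + ennreal (\<delta> / 2)"
        using f_source order_trans[OF L1_norm_push cost2] by (intro ennreal_add_less_le) auto
      finally show ?thesis unfolding half .
    qed
    have g_Tstart: "L1_norm G \<rho> (\<lambda>i s. g i s - translate_family G t start i s) < ennreal \<delta>"
    proof -
      have "L1_norm G \<rho> (\<lambda>i s. g i s - translate_family G t start i s)
          \<le> L1_norm G \<rho> (\<lambda>i s. g i s - target i s) + L1_norm G \<rho> (\<lambda>i s. target i s - translate_family G t start i s)"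
        by (intro L1_norm_diff_triangle mf target_measurable translate_start_measurable)
      also have "\<dots> < ennreal (\<delta> / 2) + ennreal (\<delta> / 2)"
        using g_target order_trans[OF L1_norm_translate_start_diff cost1]
        by (intro ennreal_add_less_le) (simp_all add: L1_norm_minus_commute[of target])
      finally show ?thesis unfolding half .
    qed
    have start: "start \<in> L1_families G \<rho>"
      using f_start by (intro L1_families_near[OF f(1) start_measurable]) (auto intro: order.strict_trans)
    have Tstart: "translate_family G t start \<in> L1_families G \<rho>"
      using g_Tstart by (intro L1_families_near[OF g(1) translate_start_measurable]) (auto intro: order.strict_trans)
    have "L1_eq G \<rho> `` {start} \<in> U"
      using f_start \<delta>(2) by (intro f(3) start) (meson ennreal_leI order.strict_trans2)
    moreover have "left_translation G \<rho> t (L1_eq G \<rho> `` {start}) \<in> V"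
      unfolding left_translation_class[OF start Tstart]
      using g_Tstart \<delta>(3) by (intro g(3) Tstart) (meson ennreal_leI order.strict_trans2)
    ultimately show "t \<in> hitting_times (left_translation G \<rho>) U V"
      using t by (auto simp: hitting_times_def)
  qed
  moreover have "N1 G \<rho> K \<epsilon> \<alpha> \<in> \<F>" using N1[OF K(1-3)] \<epsilon>(1) \<alpha>(1,2) by blast
  moreover have "hitting_times (left_translation G \<rho>) U V \<subseteq> {0..}" by (auto simp: hitting_times_def)
  ultimately show "hitting_times (left_translation G \<rho>) U V \<in> \<F>"
    using \<F> unfolding furstenberg_family_def by blast
qed

end
theorem corollary3p6:
  fixes G :: "('v, 'i) pre_digraph"
    and \<rho> :: "'i \<Rightarrow> real \<Rightarrow> real"
    and \<F> :: "real set set"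
  assumes "directed_tree G"
    and "\<not> (\<exists>v. is_root G v)"
    and "\<not> (\<exists>v. is_leaf G v)"
    and "is_weight G \<rho>"
    and "admissible1 G \<rho>"
    and "furstenberg_family \<F>"
    and "proper_family \<F>"
    and "finite_invariant \<F>"
  shows
    "(family_transitive \<F>
        (L1_topology G \<rho> :: ('i \<Rightarrow> real \<Rightarrow> 'k::{real_normed_field, euclidean_space}) set topology)
        (left_translation G \<rho>)
      \<longleftrightarrow> (\<forall>K \<epsilon> \<alpha>. finite K \<and> K \<noteq> {} \<and> K \<subseteq> arcs G \<and> \<epsilon> > 0 \<and> 0 < \<alpha> \<and> \<alpha> < 1
             \<longrightarrow> N1 G \<rho> K \<epsilon> \<alpha> \<in> \<F>))
    \<and> ((\<forall>K \<epsilon> \<alpha>. finite K \<and> K \<noteq> {} \<and> K \<subseteq> arcs G \<and> \<epsilon> > 0 \<and> 0 < \<alpha> \<and> \<alpha> < 1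
             \<longrightarrow> N1 G \<rho> K \<epsilon> \<alpha> \<in> \<F>)
      \<longleftrightarrow> family_recurrent \<F>
        (L1_topology G \<rho> :: ('i \<Rightarrow> real \<Rightarrow> 'k) set topology)
        (left_translation G \<rho>))"
proof -
  let ?trans = "family_transitive \<F>
        (L1_topology G \<rho> :: ('i \<Rightarrow> real \<Rightarrow> 'k::{real_normed_field, euclidean_space}) set topology)
        (left_translation G \<rho>)"
  let ?rec = "family_recurrent \<F> (L1_topology G \<rho> :: ('i \<Rightarrow> real \<Rightarrow> 'k) set topology) (left_translation G \<rho>)"
  let ?N = "\<forall>K \<epsilon> \<alpha>. finite K \<and> K \<noteq> {} \<and> K \<subseteq> arcs G \<and> \<epsilon> > 0 \<and> 0 < \<alpha> \<and> \<alpha> < 1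
             \<longrightarrow> N1 G \<rho> K \<epsilon> \<alpha> \<in> \<F>"
  interpret directed_tree G by (rule assms(1))
  interpret admissible_tree G \<rho>
    by unfold_locales (rule assms)+
  have "?trans \<Longrightarrow> ?rec" by (simp add: family_transitive_def family_recurrent_def)
  moreover have "?rec \<Longrightarrow> ?N" using recurrent_imp_N1 assms(6,8) by blast
  moreover have "?N \<Longrightarrow> ?trans" using N1_imp_transitive[OF _ assms(6)] by blast
  ultimately show ?thesis by blast
qed

end
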